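(* Let $G$ be a finite group of order $n$, let $\alpha,\beta:G\to\mathbb{Q}$ be class functions with $\alpha(g)=\alpha(g^{-1})$ and $\beta(g)=\beta(g^{-1})$ for all $g\in G$, and let $K$ be a field with $\mathbb{Q}\subseteq K\subseteq\mathbb{Q}(\zeta_n)$. Let $H_K=\eta(\operatorname{Gal}(\mathbb{Q}(\zeta_n)/K))$, $H_\alpha(K)=\{h\in H_K\mid \alpha^h=\alpha\}$ and $H_\beta(K)=\{h\in H_K\mid \beta^h=\beta\}$. If $H_\alpha(K)=H_\beta(K)$, then all eigenvalues of $\operatorname{Cay}(G,\alpha)$ lie in $K$ if and only if all eigenvalues of $\operatorname{Cay}(G,\beta)$ lie in $K$.
   Context: $\zeta_n=e^{2\pi i/n}$; $\eta:\operatorname{Gal}(\mathbb{Q}(\zeta_n)/\mathbb{Q})\to\mathbb{Z}_n^*$ is the isomorphism with $\sigma(\zeta_n)=\zeta_n^{\eta(\sigma)}$. For $h\in\mathbb{Z}_n^*$, $\alpha^h(g)=\alpha(g^h)$. The Cayley colour graph $\operatorname{Cay}(G,f)$ has vertex set $G$ and adjacency matrix $[f(gh^{-1})]_{g,h\in G}$; its eigenvalues are those of this matrix. *)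

theory Defs
  imports Complex_Main "HOL-Algebra.Coset"
begin

definition zeta :: "nat \<Rightarrow> complex" where
  "zeta n = exp (2 * of_real pi * \<i> / of_nat n)"

definition is_subfield :: "complex set \<Rightarrow> bool" where
  "is_subfield S \<longleftrightarrow> 0 \<in> S \<and> 1 \<in> S \<and>
     (\<forall>x\<in>S. \<forall>y\<in>S. x + y \<in> S \<and> x * y \<in> S) \<and>
     (\<forall>x\<in>S. - x \<in> S) \<and> (\<forall>x\<in>S. x \<noteq> 0 \<longrightarrow> inverse x \<in> S)"

definition cyclo_field :: "nat \<Rightarrow> complex set" where
  "cyclo_field n = \<Inter> {S. is_subfield S \<and> zeta n \<in> S}"

definition field_aut :: "complex set \<Rightarrow> (complex \<Rightarrow> complex) \<Rightarrow> bool" where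
  "field_aut F \<sigma> \<longleftrightarrow> bij_betw \<sigma> F F \<and>
     (\<forall>x\<in>F. \<forall>y\<in>F. \<sigma> (x + y) = \<sigma> x + \<sigma> y \<and> \<sigma> (x * y) = \<sigma> x * \<sigma> y)"

definition galois_group :: "nat \<Rightarrow> complex set \<Rightarrow> (complex \<Rightarrow> complex) set" where
  "galois_group n K = {\<sigma>. field_aut (cyclo_field n) \<sigma> \<and> (\<forall>x\<in>K. \<sigma> x = x)}"

definition units_mod :: "nat \<Rightarrow> nat set" where
  "units_mod n = {h. h < n \<and> coprime h n}"

text \<open>H_K = eta(Gal(Q(zeta_n)/K)), where eta(sigma) is the unit h with sigma(zeta_n) = zeta_n^h.\<close>
definition H_field :: "nat \<Rightarrow> complex set \<Rightarrow> nat set" where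
  "H_field n K = {h \<in> units_mod n. \<exists>\<sigma>\<in>galois_group n K. \<sigma> (zeta n) = zeta n ^ h}"

definition H_fun :: "('a, 'b) monoid_scheme \<Rightarrow> ('a \<Rightarrow> rat) \<Rightarrow> complex set \<Rightarrow> nat set" where
  "H_fun G \<alpha> K = {h \<in> H_field (order G) K.
      \<forall>g\<in>carrier G. \<alpha> (g [^]\<^bsub>G\<^esub> h) = \<alpha> g}"

definition class_function :: "('a, 'b) monoid_scheme \<Rightarrow> ('a \<Rightarrow> rat) \<Rightarrow> bool" where
  "class_function G \<alpha> \<longleftrightarrow>
     (\<forall>x\<in>carrier G. \<forall>g\<in>carrier G. \<alpha> (x \<otimes>\<^bsub>G\<^esub> g \<otimes>\<^bsub>G\<^esub> inv\<^bsub>G\<^esub> x) = \<alpha> g)"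

definition cay_eigenvalue :: "('a, 'b) monoid_scheme \<Rightarrow> ('a \<Rightarrow> rat) \<Rightarrow> complex \<Rightarrow> bool" where
  "cay_eigenvalue G f \<mu> \<longleftrightarrow>
     (\<exists>v :: 'a \<Rightarrow> complex. (\<exists>g\<in>carrier G. v g \<noteq> 0) \<and>
        (\<forall>g\<in>carrier G. (\<Sum>h\<in>carrier G. of_rat (f (g \<otimes>\<^bsub>G\<^esub> inv\<^bsub>G\<^esub> h)) * v h) = \<mu> * v g))"

end

theory Submission
  imports
    "HOL-Algebra.Multiplicative_Group"
    "HOL-Computational_Algebra.Fundamental_Theorem_Algebra"
    Defs
begin

text \<open>
  All eigenvalues of the Cayley colour graph of \<open>\<alpha>\<close> lie in \<open>K\<close> iff \<open>H_fun G \<alpha> K\<close> is all of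
  \<open>H_field (order G) K\<close>, a condition that depends on \<open>\<alpha>\<close> only through \<open>H_fun G \<alpha> K\<close>.
  This can be seen without character theory. The adjacency matrix is convolution by the
  self-adjoint central element \<open>a = (\<Sum>g. \<alpha> g * g)\<close> of the group algebra, so
  \<open>a = (\<Sum>\<mu>. \<mu> * e\<^sub>\<mu>)\<close> with orthogonal central idempotents \<open>e\<^sub>\<mu>\<close>, \<open>\<mu>\<close> ranging over the eigenvalues.
  For a central idempotent \<open>e\<close> and \<open>g \<in> G\<close>, the Fourier coefficients of \<open>k \<mapsto> e (g\<^sup>k)\<close> are traces of
  idempotent matrices, hence natural numbers; therefore an automorphism \<open>\<sigma>\<close> of the cyclotomic
  field with \<open>\<sigma> \<zeta> = \<zeta>\<^sup>h\<close> satisfies \<open>\<sigma> (e g) = e (g\<^sup>h)\<close>. Comparing \<open>a (g\<^sup>h) = (\<Sum>\<mu>. \<mu> * \<sigma> (e\<^sub>\<mu> g))\<close> with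
  \<open>a g = \<sigma> (a g) = (\<Sum>\<mu>. \<sigma> \<mu> * \<sigma> (e\<^sub>\<mu> g))\<close> shows that \<open>\<alpha> (g\<^sup>h) = \<alpha> g\<close> for all \<open>g\<close> iff \<open>\<sigma>\<close> fixes every
  eigenvalue, and the Galois correspondence for \<open>K\<close> finishes the argument.
\<close>

hide_const (open) Polynomial.order

section \<open>Roots of unity\<close>

lemma zeta_power: "zeta n ^ k = exp (2 * of_real pi * \<i> * of_nat k / of_nat n)"
  unfolding zeta_def by (simp add: exp_of_nat_mult [symmetric] field_simps)

lemma zeta_power_order [simp]: "n > 0 \<Longrightarrow> zeta n ^ n = 1"
  by (simp add: zeta_power)

lemma bij_betw_zeta_power:
  assumes "n > 0"
  shows "bij_betw (\<lambda>k. zeta n ^ k) {..<n} {z. z ^ n = 1}"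
proof -
  have "(\<lambda>k. zeta n ^ k) = (\<lambda>k. cis (2 * pi * real k / real n))"
    by (rule ext) (simp add: zeta_power cis_conv_exp field_simps)
  thus ?thesis using bij_betw_roots_unity[OF assms] by simp
qed

lemma zeta_power_eq_1_iff:
  assumes "n > 0" shows "zeta n ^ k = 1 \<longleftrightarrow> n dvd k"
proof -
  have "zeta n ^ k = zeta n ^ (k mod n)"
    using assms by (subst mult_div_mod_eq [of n k, symmetric])
      (simp only: power_add power_mult zeta_power_order power_one mult_1)
  also have "\<dots> = 1 \<longleftrightarrow> k mod n = 0"
    using bij_betw_imp_inj_on[OF bij_betw_zeta_power[OF assms]] assms
    by (auto simp: inj_on_def dest: bspec[of _ _ "k mod n"] bspec[of _ _ 0])
  finally show ?thesis by (simp add: dvd_eq_mod_eq_0)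
qed

lemma sum_zeta_power:
  assumes "n > 0"
  shows "(\<Sum>j<n. (zeta n ^ k) ^ j) = (if n dvd k then of_nat n else 0)"
proof (cases "n dvd k")
  case True
  hence "zeta n ^ k = 1" by (simp add: zeta_power_eq_1_iff assms)
  thus ?thesis using True by simp
next
  case False
  hence "zeta n ^ k \<noteq> 1" by (simp add: zeta_power_eq_1_iff assms)
  moreover have "(zeta n ^ k) ^ n = 1"
    by (metis assms mult.commute power_mult power_one zeta_power_order)
  ultimately show ?thesis using False by (simp add: sum_gp_strict)
qed

section \<open>Subfields of the complex numbers\<close>

locale complex_subfield =
  fixes K :: "complex set"
  assumes subfield: "is_subfield K"
begin

lemma zero_mem [simp]: "0 \<in> K" and one_mem [simp]: "1 \<in> K"
  and add_mem: "x \<in> K \<Longrightarrow> y \<in> K \<Longrightarrow> x + y \<in> K"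
  and mult_mem: "x \<in> K \<Longrightarrow> y \<in> K \<Longrightarrow> x * y \<in> K"
  and uminus_mem: "x \<in> K \<Longrightarrow> - x \<in> K"
  using subfield by (auto simp: is_subfield_def)

lemma inverse_mem: "x \<in> K \<Longrightarrow> inverse x \<in> K"
  using subfield by (cases "x = 0") (auto simp: is_subfield_def)

lemma diff_mem: "x \<in> K \<Longrightarrow> y \<in> K \<Longrightarrow> x - y \<in> K"
  using add_mem[of x "- y"] by (simp add: uminus_mem)

lemma divide_mem: "x \<in> K \<Longrightarrow> y \<in> K \<Longrightarrow> x / y \<in> K"
  by (simp add: divide_inverse mult_mem inverse_mem)

lemma power_mem: "x \<in> K \<Longrightarrow> x ^ k \<in> K"
  by (induction k) (auto intro: mult_mem)

lemma sum_mem: "(\<And>i. i \<in> I \<Longrightarrow> f i \<in> K) \<Longrightarrow> sum f I \<in> K"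
  by (induction I rule: infinite_finite_induct) (auto intro: add_mem)

lemma of_nat_mem: "of_nat k \<in> K"
  by (induction k) (auto intro: add_mem)

lemma of_int_mem: "of_int k \<in> K"
  by (cases k) (auto intro: of_nat_mem uminus_mem simp del: of_nat_Suc)

lemma of_rat_mem: "of_rat r \<in> K"
proof (cases r)
  case (Fract a b)
  thus ?thesis by (simp add: of_rat_rat divide_mem of_int_mem)
qed

text \<open>This is the ring K[X], kept as a set of complex polynomials because \<open>K\<close> is
  a set and not a type. Division with remainder must therefore be shown to stay over
  \<open>K\<close>.\<close>

definition polys :: "complex poly set" where
  "polys = {p. \<forall>i. coeff p i \<in> K}"

lemma polys_0 [simp]: "0 \<in> polys" and polys_1 [simp]: "1 \<in> polys"
  by (auto simp: polys_def coeff_1)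

lemma polys_const: "c \<in> K \<Longrightarrow> [:c:] \<in> polys"
  by (auto simp: polys_def coeff_pCons split: nat.splits)

lemma polys_monom: "c \<in> K \<Longrightarrow> monom c k \<in> polys"
  by (auto simp: polys_def)

lemma polys_add: "p \<in> polys \<Longrightarrow> q \<in> polys \<Longrightarrow> p + q \<in> polys"
  and polys_diff: "p \<in> polys \<Longrightarrow> q \<in> polys \<Longrightarrow> p - q \<in> polys"
  and polys_uminus: "p \<in> polys \<Longrightarrow> - p \<in> polys"
  by (auto simp: polys_def intro: add_mem diff_mem uminus_mem)

lemma polys_mult: "p \<in> polys \<Longrightarrow> q \<in> polys \<Longrightarrow> p * q \<in> polys"
  by (auto simp: polys_def coeff_mult intro!: sum_mem mult_mem)

lemma polys_division:
  assumes p: "p \<in> polys" and m: "m \<in> polys" "m \<noteq> 0"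
  obtains q r where "q \<in> polys" "r \<in> polys" "p = q * m + r" "r = 0 \<or> degree r < degree m"
proof -
  have "\<exists>q\<in>polys. \<exists>r\<in>polys. p = q * m + r \<and> (r = 0 \<or> degree r < degree m)"
    using p
  proof (induction "degree p" arbitrary: p rule: less_induct)
    case less
    show ?case
    proof (cases "p = 0 \<or> degree p < degree m")
      case True
      thus ?thesis using less.prems by (intro bexI[of _ 0] bexI[of _ p]) auto
    next
      case False
      \<comment> \<open>Schoolbook long division: \<open>t * m\<close> cancels the leading term of
        \<open>p\<close>, and \<open>t\<close> stays over \<open>K\<close> because \<open>K\<close>
        is closed under division.\<close>
      define t where "t = monom (lead_coeff p / lead_coeff m) (degree p - degree m)"
      have t: "t \<in> polys"
        using less.prems m unfolding t_def by (intro polys_monom divide_mem) (auto simp: polys_def)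
      define p' where "p' = p - t * m"
      have p': "p' \<in> polys" unfolding p'_def using less.prems t m by (intro polys_diff polys_mult)
      have lt: "lead_coeff p / lead_coeff m \<noteq> 0" using False m by auto
      have deg: "degree (t * m) = degree p"
        using False lt m by (subst degree_mult_eq) (auto simp: t_def degree_monom_eq)
      have "coeff (t * m) (degree p) = lead_coeff p"
        using lead_coeff_mult[of t m] m lt unfolding deg by (simp add: t_def degree_monom_eq)
      hence c0: "coeff p' (degree p) = 0" by (simp add: p'_def)
      have "degree p' \<le> degree p"
        unfolding p'_def using degree_diff_le[of p "degree p" "t * m"] deg by simp
      \<comment> \<open>The alternative \<open>p' = 0\<close> is needed when \<open>degree p\<close>
        is 0, where the degree cannot drop. Quotient and remainder of \<open>p'\<close> are then
        both 0.\<close>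
      hence "p' = 0 \<or> degree p' < degree p"
        using c0 by (metis leading_coeff_0_iff order_le_less)
      then obtain q r where "q \<in> polys" "r \<in> polys" "p' = q * m + r" "r = 0 \<or> degree r < degree m"
        using less.hyps[OF _ p'] by (metis add_0 mult_zero_left polys_0)
      thus ?thesis using t
        by (intro bexI[of _ "q + t"] bexI[of _ r]) (auto simp: p'_def algebra_simps intro: polys_add)
    qed
  qed
  thus ?thesis using that by blast
qed

end

lemma complex_subfield_cyclo_field: "complex_subfield (cyclo_field n)"
  unfolding complex_subfield_def is_subfield_def [of "cyclo_field n"]
  by (auto simp: cyclo_field_def is_subfield_def)

lemma zeta_in_cyclo_field: "zeta n \<in> cyclo_field n"
  by (auto simp: cyclo_field_def)

lemma cyclo_field_least: "is_subfield S \<Longrightarrow> zeta n \<in> S \<Longrightarrow> cyclo_field n \<subseteq> S"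
  by (auto simp: cyclo_field_def)

section \<open>Automorphisms of cyclotomic fields\<close>

locale cyclo_aut =
  fixes n :: nat and \<sigma> :: "complex \<Rightarrow> complex"
  assumes n_pos: "n > 0" and aut: "field_aut (cyclo_field n) \<sigma>"
begin

sublocale L: complex_subfield "cyclo_field n"
  by (rule complex_subfield_cyclo_field)

lemma aut_add: "x \<in> cyclo_field n \<Longrightarrow> y \<in> cyclo_field n \<Longrightarrow> \<sigma> (x + y) = \<sigma> x + \<sigma> y"
  and aut_mult: "x \<in> cyclo_field n \<Longrightarrow> y \<in> cyclo_field n \<Longrightarrow> \<sigma> (x * y) = \<sigma> x * \<sigma> y"
  and aut_inj: "inj_on \<sigma> (cyclo_field n)"
  and aut_image: "\<sigma> ` cyclo_field n = cyclo_field n"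
  using aut by (auto simp: field_aut_def bij_betw_def)

lemma aut_0 [simp]: "\<sigma> 0 = 0"
  using aut_add[of 0 0] by simp

lemma aut_1 [simp]: "\<sigma> 1 = 1"
proof -
  have "\<sigma> 1 \<noteq> \<sigma> 0" using aut_inj by (metis inj_on_def L.zero_mem L.one_mem zero_neq_one)
  moreover have "\<sigma> 1 * \<sigma> 1 = \<sigma> 1" using aut_mult[of 1 1] by simp
  ultimately show ?thesis by simp
qed

lemma aut_sum:
  "(\<And>i. i \<in> I \<Longrightarrow> f i \<in> cyclo_field n) \<Longrightarrow> \<sigma> (sum f I) = (\<Sum>i\<in>I. \<sigma> (f i))"
  by (induction I rule: infinite_finite_induct) (auto simp: aut_add L.sum_mem)

lemma aut_power: "x \<in> cyclo_field n \<Longrightarrow> \<sigma> (x ^ k) = \<sigma> x ^ k"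
  by (induction k) (auto simp: aut_mult L.power_mem)

lemma aut_of_nat: "\<sigma> (of_nat k) = of_nat k"
  by (induction k) (auto simp: aut_add L.of_nat_mem)

lemma aut_uminus: "x \<in> cyclo_field n \<Longrightarrow> \<sigma> (- x) = - \<sigma> x"
  using aut_add[of "- x" x] L.uminus_mem[of x] by (simp add: eq_neg_iff_add_eq_0)

lemma aut_of_int: "\<sigma> (of_int k) = of_int k"
  by (cases k) (auto simp: aut_of_nat aut_uminus L.of_nat_mem simp del: of_nat_Suc)

lemma aut_of_rat: "\<sigma> (of_rat r) = of_rat r"
proof (cases r)
  case (Fract a b)
  have eq: "of_rat r * of_int b = (of_int a :: complex)"
    unfolding Fract(1) using Fract(2) by (simp add: of_rat_rat)
  hence "\<sigma> (of_rat r) * of_int b = of_int a"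
    by (metis aut_mult aut_of_int L.of_rat_mem L.of_int_mem)
  moreover have "of_int b \<noteq> (0 :: complex)" using Fract(2) by simp
  ultimately show ?thesis using eq by (metis mult_right_cancel)
qed

text \<open>The image of \<open>zeta n\<close> is again an n-th root of unity, hence some power h.
  With d = gcd(h, n), the automorphism sends zeta^(n/d) to 1, so injectivity gives zeta^(n/d) = 1
  and thus d = 1.\<close>

lemma aut_zeta:
  obtains h where "h \<in> units_mod n" "\<sigma> (zeta n) = zeta n ^ h"
proof -
  have "\<sigma> (zeta n) ^ n = 1"
    using aut_power[of "zeta n" n] n_pos zeta_in_cyclo_field by simp
  then obtain h where h: "h < n" "\<sigma> (zeta n) = zeta n ^ h"
    using bij_betw_imp_surj_on[OF bij_betw_zeta_power[OF n_pos]] by blast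
  define d where "d = gcd h n"
  obtain h' n' where d: "h = d * h'" "n = d * n'"
    by (metis d_def dvd_def gcd_dvd1 gcd_dvd2)
  have pos: "d > 0" "n' > 0" using n_pos d by auto
  have "h * n' = n * h'" by (subst d(1), subst d(2)) simp
  hence "\<sigma> (zeta n ^ n') = \<sigma> 1"
    using h n_pos zeta_in_cyclo_field
    by (simp add: aut_power power_mult [symmetric] zeta_power_eq_1_iff)
  hence "zeta n ^ n' = 1"
    using aut_inj zeta_in_cyclo_field by (metis inj_onD L.one_mem L.power_mem)
  hence "d * n' dvd 1 * n'" using d n_pos by (simp add: zeta_power_eq_1_iff)
  hence "d = 1" using pos by (auto dest!: dvd_imp_le)
  hence "h \<in> units_mod n" using h by (simp add: units_mod_def d_def coprime_iff_gcd_eq_1)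
  thus ?thesis using h that by blast
qed

end

section \<open>The fixed field of the Galois group\<close>

text \<open>Here \<open>m\<close> is a minimal polynomial of \<open>zeta n\<close> over
  \<open>K\<close>, up to a scalar factor: it is characterised by least degree and not normalised to
  be monic.\<close>

locale cyclo_min_poly = complex_subfield +
  fixes n :: nat and m :: "complex poly"
  assumes n_pos: "n > 0" and K_subset: "K \<subseteq> cyclo_field n"
    and m: "m \<in> polys" "m \<noteq> 0" "poly m (zeta n) = 0"
    and m_minimal: "\<And>p. p \<in> polys \<Longrightarrow> poly p (zeta n) = 0 \<Longrightarrow> p \<noteq> 0 \<Longrightarrow> degree m \<le> degree p"
begin

sublocale L: complex_subfield "cyclo_field n"
  by (rule complex_subfield_cyclo_field)

lemma zero_of_small_degree:
  "p \<in> polys \<Longrightarrow> poly p (zeta n) = 0 \<Longrightarrow> degree p < degree m \<Longrightarrow> p = 0"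
  using m_minimal[of p] by fastforce

lemma m_dvd:
  assumes "p \<in> polys" "poly p (zeta n) = 0"
  shows "m dvd p"
proof -
  obtain q r where qr: "q \<in> polys" "r \<in> polys" "p = q * m + r" "r = 0 \<or> degree r < degree m"
    using polys_division[OF assms(1) m(1,2)] .
  have "poly r (zeta n) = 0" using qr(3) assms(2) m(3) by simp
  hence "r = 0" using qr zero_of_small_degree by blast
  thus ?thesis using qr by simp
qed

lemma m_root_power_eq_1:
  assumes "poly m z = 0" shows "z ^ n = 1"
proof -
  have "m dvd monom 1 n - 1"
    using n_pos by (intro m_dvd polys_diff polys_monom) (auto simp: poly_monom)
  hence "poly (monom 1 n - 1) z = 0" using assms by (metis dvd_trans poly_eq_0_iff_dvd)
  thus ?thesis by (simp add: poly_monom)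
qed

text \<open>Separability: \<open>m\<close> divides X^n - 1, and a multiple root of \<open>m\<close>
  would be a common root of X^n - 1 and its derivative n X^(n-1), which is impossible.\<close>

lemma card_roots_m: "card {z. poly m z = 0} = degree m"
proof -
  have "m dvd monom 1 n - 1"
    using n_pos by (intro m_dvd polys_diff polys_monom) (auto simp: poly_monom)
  then obtain q where q: "monom 1 n - 1 = m * q" by (auto simp: dvd_def)
  have "rsquarefree m"
    unfolding rsquarefree_roots
  proof (intro allI notI, elim conjE)
    fix z assume z: "poly m z = 0" "poly (pderiv m) z = 0"
    have "poly (pderiv (monom 1 n - 1)) z = 0" using z by (simp add: q pderiv_mult)
    hence "z ^ (n - 1) = 0" using n_pos by (simp add: pderiv_diff pderiv_monom poly_monom)
    thus False using m_root_power_eq_1[OF z(1)] n_pos by (auto simp: power_0_left)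
  qed
  hence "smult (lead_coeff m) (\<Prod>z | poly m z = 0. [:- z, 1:]) = m"
    by (rule complex_poly_decompose_rsquarefree)
  moreover have "degree (\<Prod>z | poly m z = 0. [:- z, 1:]) = card {z. poly m z = 0}"
    by (subst degree_prod_eq_sum_degree) auto
  ultimately show ?thesis using m(2) by (metis degree_smult_eq leading_coeff_0_iff)
qed

lemma degree_m_pos: "degree m > 0"
  using m by (metis degree_eq_zeroE gr0I pCons_0_0 poly_const_conv)

text \<open>Euclidean descent: from m = q p + r follows r(zeta) = - q(zeta) p(zeta), so an inverse
  of r(zeta), where r has smaller degree, yields one of p(zeta).\<close>

lemma inverse_adjoin:
  assumes "p \<in> polys" "poly p (zeta n) \<noteq> 0" "degree p < degree m"
  shows "\<exists>q\<in>polys. poly q (zeta n) * poly p (zeta n) = 1"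
  using assms
proof (induction "degree p" arbitrary: p rule: less_induct)
  case less
  show ?case
  proof (cases "degree p = 0")
    case True
    then obtain c where c: "p = [:c:]" by (rule degree_eq_zeroE)
    hence "c \<in> K" "c \<noteq> 0" using less.prems by (auto simp: polys_def dest: spec[of _ 0])
    thus ?thesis using c by (intro bexI[of _ "[:inverse c:]"] polys_const inverse_mem) auto
  next
    case False
    hence p0: "p \<noteq> 0" by auto
    obtain q r where qr: "q \<in> polys" "r \<in> polys" "m = q * p + r" "r = 0 \<or> degree r < degree p"
      using polys_division[OF m(1) less.prems(1) p0] .
    have eq: "poly r (zeta n) = - poly q (zeta n) * poly p (zeta n)"
      using m(3) unfolding qr(3) by (simp add: eq_neg_iff_add_eq_0 add.commute)
    \<comment> \<open>Otherwise q would annihilate \<open>zeta n\<close> with degree below that of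
      \<open>m\<close>, since p is not constant.\<close>
    have "r \<noteq> 0"
    proof
      assume r: "r = 0"
      hence "poly q (zeta n) = 0" using eq less.prems by simp
      moreover have "q \<noteq> 0" using qr r m by auto
      moreover have "degree m = degree q + degree p"
        using qr(3) r p0 \<open>q \<noteq> 0\<close> by (simp add: degree_mult_eq)
      ultimately show False using zero_of_small_degree[OF qr(1)] False by auto
    qed
    hence deg: "degree r < degree p" using qr by auto
    hence "poly r (zeta n) \<noteq> 0"
      using zero_of_small_degree[OF qr(2)] \<open>r \<noteq> 0\<close> less.prems by force
    then obtain s where s: "s \<in> polys" "poly s (zeta n) * poly r (zeta n) = 1"
      using less.hyps[OF deg qr(2)] less.prems deg by auto
    show ?thesis
      using s qr(1) eq by (intro bexI[of _ "- (s * q)"] polys_uminus polys_mult) (auto simp: mult_ac)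
  qed
qed

lemma small_representative:
  assumes "p \<in> polys"
  obtains r where "r \<in> polys" "poly r (zeta n) = poly p (zeta n)" "degree r < degree m"
proof -
  obtain q r where qr: "q \<in> polys" "r \<in> polys" "p = q * m + r" "r = 0 \<or> degree r < degree m"
    using polys_division[OF assms m(1,2)] .
  \<comment> \<open>A zero remainder also has degree below \<open>degree m\<close>, because
    \<open>m\<close> is not constant.\<close>
  show ?thesis using that[of r] qr m(3) degree_m_pos by auto
qed

lemma adjoin_subfield: "is_subfield ((\<lambda>p. poly p (zeta n)) ` polys)" (is "is_subfield ?R")
  unfolding is_subfield_def
proof (intro conjI ballI impI)
  show "0 \<in> ?R" "1 \<in> ?R" by (auto intro: rev_image_eqI[of 0] rev_image_eqI[of 1])
next
  fix x assume "x \<in> ?R"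
  then obtain p where p: "p \<in> polys" "x = poly p (zeta n)" by auto
  show "- x \<in> ?R" using p by (intro rev_image_eqI[of "- p"] polys_uminus) auto
  assume "x \<noteq> 0"
  obtain r where r: "r \<in> polys" "poly r (zeta n) = x" "degree r < degree m"
    using small_representative[OF p(1)] p(2) by metis
  then obtain q where "q \<in> polys" "poly q (zeta n) * x = 1"
    using inverse_adjoin \<open>x \<noteq> 0\<close> by blast
  thus "inverse x \<in> ?R" by (intro rev_image_eqI[of q]) (auto simp: field_simps \<open>x \<noteq> 0\<close>)
next
  fix x y assume "x \<in> ?R" "y \<in> ?R"
  then obtain p q where "p \<in> polys" "x = poly p (zeta n)" "q \<in> polys" "y = poly q (zeta n)" by auto
  thus "x + y \<in> ?R" "x * y \<in> ?R"
    by (auto intro: rev_image_eqI[of "p + q"] rev_image_eqI[of "p * q"] polys_add polys_mult)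
qed

lemma cyclo_field_eq: "cyclo_field n = (\<lambda>p. poly p (zeta n)) ` polys"
proof
  have "zeta n \<in> (\<lambda>p. poly p (zeta n)) ` polys"
    by (intro rev_image_eqI[of "monom 1 1"] polys_monom) (auto simp: poly_monom)
  thus "cyclo_field n \<subseteq> (\<lambda>p. poly p (zeta n)) ` polys"
    by (intro cyclo_field_least adjoin_subfield)
next
  show "(\<lambda>p. poly p (zeta n)) ` polys \<subseteq> cyclo_field n"
    using K_subset
    by (auto simp: poly_altdef polys_def intro!: L.sum_mem L.mult_mem L.power_mem zeta_in_cyclo_field)
qed

text \<open>The K-homomorphism from K[zeta] that sends zeta to z. The choice of representative is
  immaterial when z is a root of \<open>m\<close>, since two representatives differ by a multiple of
  \<open>m\<close>.\<close>

definition conjugation :: "complex \<Rightarrow> complex \<Rightarrow> complex" where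
  "conjugation z y = poly (SOME p. p \<in> polys \<and> poly p (zeta n) = y) z"

lemma conjugation_poly:
  assumes "poly m z = 0" "p \<in> polys"
  shows "conjugation z (poly p (zeta n)) = poly p z"
proof -
  define q where "q = (SOME q. q \<in> polys \<and> poly q (zeta n) = poly p (zeta n))"
  have q: "q \<in> polys \<and> poly q (zeta n) = poly p (zeta n)"
    unfolding q_def by (rule someI[of _ p]) (use assms in auto)
  hence "m dvd q - p" using assms by (intro m_dvd polys_diff) auto
  hence "poly (q - p) z = 0" using assms(1) by (metis dvd_trans poly_eq_0_iff_dvd)
  thus ?thesis by (simp add: conjugation_def q_def)
qed

text \<open>The map is a K-homomorphism by \<open>conjugation_poly\<close>, is injective because
  nonzero elements have inverses, and stays in the cyclotomic field because z is a power of
  \<open>zeta n\<close>.\<close>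

lemma conjugation_mem:
  assumes z: "poly m z = 0" shows "conjugation z \<in> galois_group n K"
proof -
  let ?\<sigma> = "conjugation z" and ?L = "cyclo_field n"
  have add: "?\<sigma> (x + y) = ?\<sigma> x + ?\<sigma> y" and mult: "?\<sigma> (x * y) = ?\<sigma> x * ?\<sigma> y"
    if xy: "x \<in> ?L" "y \<in> ?L" for x y
  proof -
    obtain p q where p: "p \<in> polys" "x = poly p (zeta n)" and q: "q \<in> polys" "y = poly q (zeta n)"
      using xy unfolding cyclo_field_eq by auto
    show "?\<sigma> (x + y) = ?\<sigma> x + ?\<sigma> y"
      using conjugation_poly[OF z polys_add[OF p(1) q(1)]] p q by (simp add: conjugation_poly z)
    show "?\<sigma> (x * y) = ?\<sigma> x * ?\<sigma> y"
      using conjugation_poly[OF z polys_mult[OF p(1) q(1)]] p q by (simp add: conjugation_poly z)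
  qed
  have fixed: "?\<sigma> c = c" if "c \<in> K" for c
    using conjugation_poly[OF z polys_const[OF that]] by simp
  have nz: "?\<sigma> x \<noteq> 0" if "x \<in> ?L" "x \<noteq> 0" for x
    using mult[OF that(1) L.inverse_mem[OF that(1)]] that fixed[of 1] by auto
  have inj: "inj_on ?\<sigma> ?L"
  proof
    fix x y assume xy: "x \<in> ?L" "y \<in> ?L" "?\<sigma> x = ?\<sigma> y"
    have "?\<sigma> (x - y) + ?\<sigma> y = ?\<sigma> x"
      using add[OF L.diff_mem[OF xy(1,2)] xy(2)] by simp
    hence "?\<sigma> (x - y) = 0" using xy by simp
    thus "x = y" using nz[of "x - y"] xy L.diff_mem by auto
  qed
  have zL: "z \<in> ?L"
    using m_root_power_eq_1[OF z] bij_betw_imp_surj_on[OF bij_betw_zeta_power[OF n_pos]]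
      L.power_mem[OF zeta_in_cyclo_field] by force
  have into: "?\<sigma> x \<in> ?L" if x: "x \<in> ?L" for x
  proof -
    obtain p where p: "p \<in> polys" "x = poly p (zeta n)" using x unfolding cyclo_field_eq by auto
    have "poly p z \<in> ?L"
      using p(1) zL K_subset by (auto simp: poly_altdef polys_def intro!: L.sum_mem L.mult_mem L.power_mem)
    thus ?thesis using p by (simp add: conjugation_poly z)
  qed
  \<comment> \<open>Surjectivity: the finite group of \<open>n\<close>-th roots of unity is permuted, so \<open>zeta n\<close> has a preimage.\<close>
  have sub: "{w. w ^ n = 1} \<subseteq> ?L"
    using bij_betw_imp_surj_on[OF bij_betw_zeta_power[OF n_pos]]
      L.power_mem[OF zeta_in_cyclo_field] by force
  have pw: "?\<sigma> (x ^ k) = ?\<sigma> x ^ k" if "x \<in> ?L" for x k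
    using that fixed[of 1] by (induction k) (auto simp: mult L.power_mem)
  have "?\<sigma> ` {w. w ^ n = 1} \<subseteq> {w. w ^ n = 1}"
    using pw[of _ n] sub fixed[of 1] by fastforce
  hence "?\<sigma> ` {w. w ^ n = 1} = {w. w ^ n = 1}"
    using endo_inj_surj[OF finite_roots_unity[of n]] n_pos inj_on_subset[OF inj sub] by auto
  then obtain w where w: "w \<in> ?L" "?\<sigma> w = zeta n"
    using sub n_pos by (smt (verit) imageE mem_Collect_eq subsetD zeta_power_order)
  \<comment> \<open>Coefficients in \<open>K\<close> are fixed and w goes to \<open>zeta n\<close>,
    so p(w) is a preimage of p(zeta).\<close>
  have "x \<in> ?\<sigma> ` ?L" if x: "x \<in> ?L" for x
  proof -
    obtain p where p: "p \<in> polys" "x = poly p (zeta n)" using x unfolding cyclo_field_eq by auto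
    have mem: "coeff p i * w ^ i \<in> ?L" "coeff p i \<in> ?L" for i
      using p(1) K_subset w by (auto simp: polys_def intro!: L.mult_mem L.power_mem)
    have sum: "?\<sigma> (\<Sum>i\<in>I. coeff p i * w ^ i) = (\<Sum>i\<in>I. coeff p i * zeta n ^ i)" if "finite I" for I
      using that
    proof (induction I)
      case (insert i I)
      have "?\<sigma> (coeff p i * w ^ i) = coeff p i * zeta n ^ i"
        using p(1) w mem by (auto simp: mult L.power_mem pw polys_def fixed)
      thus ?case using insert mem by (simp add: add L.sum_mem)
    qed (use fixed[of 0] in simp)
    have "?\<sigma> (poly p w) = x" using sum[of "{..degree p}"] p by (simp add: poly_altdef)
    moreover have "poly p w \<in> ?L" using mem by (auto simp: poly_altdef intro: L.sum_mem)
    ultimately show ?thesis by blast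
  qed
  hence "bij_betw ?\<sigma> ?L ?L" using inj into by (auto simp: bij_betw_def)
  thus ?thesis using add mult fixed by (auto simp: galois_group_def field_aut_def)
qed

text \<open>Write x = r(zeta) with deg r < deg m. Every root z of \<open>m\<close> satisfies r(z) =
  x, as the conjugation to z fixes x. So r - x has at least deg m roots, hence is zero, and x is the
  constant coefficient of r.\<close>

lemma fixed_imp_mem:
  assumes x: "x \<in> cyclo_field n" and fixed: "\<And>\<sigma>. \<sigma> \<in> galois_group n K \<Longrightarrow> \<sigma> x = x"
  shows "x \<in> K"
proof -
  obtain p where p: "p \<in> polys" "x = poly p (zeta n)" using x unfolding cyclo_field_eq by auto
  obtain r where r: "r \<in> polys" "poly r (zeta n) = x" "degree r < degree m"
    using small_representative[OF p(1)] p(2) by metis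
  have roots: "{z. poly m z = 0} \<subseteq> {z. poly (r - [:x:]) z = 0}"
    using r conjugation_poly conjugation_mem fixed by fastforce
  have "r - [:x:] = 0"
  proof (rule ccontr)
    assume nz: "r - [:x:] \<noteq> 0"
    have "degree m \<le> card {z. poly (r - [:x:]) z = 0}"
      unfolding card_roots_m[symmetric] by (rule card_mono[OF poly_roots_finite[OF nz] roots])
    also have "\<dots> \<le> degree (r - [:x:])" by (rule card_poly_roots_bound[OF nz])
    also have "\<dots> \<le> degree r" by (rule degree_diff_le) auto
    finally show False using r by simp
  qed
  hence "coeff r 0 = x" by simp
  thus ?thesis using r(1) by (auto simp: polys_def)
qed

end

text \<open>The direction of the Galois correspondence that recovers membership in \<open>K\<close>
  from invariance. A polynomial \<open>m\<close> of least degree exists because X^n - 1 annihilates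
  \<open>zeta n\<close>.\<close>

theorem fixed_by_galois_group_imp_mem:
  assumes "n > 0" "is_subfield K" "K \<subseteq> cyclo_field n" "x \<in> cyclo_field n"
    and "\<And>\<sigma>. \<sigma> \<in> galois_group n K \<Longrightarrow> \<sigma> x = x"
  shows "x \<in> K"
proof -
  interpret complex_subfield K by standard fact
  define P where "P p \<longleftrightarrow> p \<in> polys \<and> p \<noteq> 0 \<and> poly p (zeta n) = 0" for p
  have "monom 1 n - 1 \<noteq> (0 :: complex poly)"
    using assms(1) by (metis degree_1 degree_monom_eq eq_iff_diff_eq_0 less_numeral_extra(3) zero_neq_one)
  hence "P (monom 1 n - 1)"
    using assms(1) by (auto simp: P_def poly_monom intro!: polys_diff polys_monom)
  then obtain m where m: "P m" "\<And>p. P p \<Longrightarrow> degree m \<le> degree p"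
    using ex_has_least_nat[of P _ degree] by blast
  interpret cyclo_min_poly K n m
    by standard (use m assms in \<open>auto simp: P_def\<close>)
  show ?thesis using fixed_imp_mem assms by blast
qed

section \<open>Linear algebra over finite index sets\<close>

lemma homogeneous_system_nontrivial_solution:
  fixes M :: "'s \<Rightarrow> 'i \<Rightarrow> 'f :: field"
  assumes "finite S" "finite I" "card S < card I"
  shows "\<exists>c. (\<exists>i\<in>I. c i \<noteq> 0) \<and> (\<forall>s\<in>S. (\<Sum>i\<in>I. M s i * c i) = 0)"
  using assms
proof (induction S arbitrary: I M rule: finite_induct)
  case empty
  hence "I \<noteq> {}" by auto
  thus ?case by (intro exI[of _ "\<lambda>_. 1"]) auto
next
  case (insert s S)
  show ?case
  proof (cases "\<forall>i\<in>I. M s i = 0")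
    case True
    have "card S < card I" using insert by simp
    then obtain c where c: "\<exists>i\<in>I. c i \<noteq> 0" "\<forall>s\<in>S. (\<Sum>i\<in>I. M s i * c i) = 0"
      using insert.IH[of I M] insert.prems by blast
    moreover have "(\<Sum>i\<in>I. M s i * c i) = 0" using True by simp
    ultimately show ?thesis by blast
  next
    case False
    then obtain k where k: "k \<in> I" "M s k \<noteq> 0" by auto
    define J where "J = I - {k}"
    have J: "finite J" "k \<notin> J" "I = insert k J" using insert k by (auto simp: J_def)
    have "card S < card J" using insert J by simp
    then obtain c where c: "\<exists>i\<in>J. c i \<noteq> 0"
        "\<And>t. t \<in> S \<Longrightarrow> (\<Sum>i\<in>J. (M t i - M t k * M s i / M s k) * c i) = 0"
      using insert.IH[of J "\<lambda>t i. M t i - M t k * M s i / M s k"] J by blast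
    \<comment> \<open>Back substitution: the value at k is the one that solves equation s.\<close>
    define d where "d = c(k := - (\<Sum>i\<in>J. M s i * c i) / M s k)"
    have d: "(\<Sum>i\<in>I. M t i * d i) = M t k * d k + (\<Sum>i\<in>J. M t i * c i)" for t
      unfolding J(3) using J by (auto simp: d_def intro!: sum.cong)
    have "(\<Sum>i\<in>I. M s i * d i) = 0" unfolding d using k by (simp add: d_def)
    moreover have "(\<Sum>i\<in>I. M t i * d i) = 0" if "t \<in> S" for t
    proof -
      have "0 = (\<Sum>i\<in>J. M t i * c i) - (\<Sum>i\<in>J. M t k / M s k * (M s i * c i))"
        unfolding c(2)[OF that, symmetric] sum_subtractf [symmetric]
        by (intro sum.cong refl) (simp add: left_diff_distrib)
      also have "\<dots> = (\<Sum>i\<in>I. M t i * d i)"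
        unfolding d by (simp add: d_def sum_distrib_left sum_divide_distrib)
      finally show ?thesis by simp
    qed
    moreover have "\<exists>i\<in>I. d i \<noteq> 0" using c(1) J by (auto simp: d_def)
    ultimately show ?thesis by (intro exI[of _ d]) auto
  qed
qed

text \<open>Subtracting the rank-one idempotent \<open>v w\<close> built from a column and a row of \<open>M\<close>
  lowers the trace by one and kills a row without reviving any row that is already zero.\<close>

lemma trace_idempotent_in_Nats:
  fixes M :: "'s \<Rightarrow> 's \<Rightarrow> 'f :: field"
  assumes "finite S" "\<And>s t. s \<in> S \<Longrightarrow> t \<in> S \<Longrightarrow> (\<Sum>u\<in>S. M s u * M u t) = M s t"
  shows "(\<Sum>s\<in>S. M s s) \<in> \<nat>"
  using assms(2)
proof (induction "card {s\<in>S. \<exists>t\<in>S. M s t \<noteq> 0}" arbitrary: M rule: less_induct)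
  case less
  note idem = less.prems
  show ?case
  proof (cases "\<exists>s\<in>S. \<exists>t\<in>S. M s t \<noteq> 0")
    case False
    hence "(\<Sum>s\<in>S. M s s) = 0" by (intro sum.neutral) auto
    thus ?thesis by simp
  next
    case True
    then obtain a b where ab: "a \<in> S" "b \<in> S" "M a b \<noteq> 0" by auto
    define v where "v s = M s b" for s
    define w where "w t = M a t / M a b" for t
    define N where "N s t = M s t - v s * w t" for s t
    have Mv: "(\<Sum>u\<in>S. M s u * v u) = v s" if "s \<in> S" for s
      using idem[OF that ab(2)] by (simp add: v_def)
    have wM: "(\<Sum>u\<in>S. w u * M u t) = w t" if "t \<in> S" for t
      using idem[OF ab(1) that] by (simp add: w_def sum_divide_distrib [symmetric])
    have wv: "(\<Sum>u\<in>S. w u * v u) = 1"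
      using idem[OF ab(1,2)] ab(3) by (simp add: w_def v_def sum_divide_distrib [symmetric])
    have "(\<Sum>u\<in>S. N s u * N u t) = N s t" if "s \<in> S" "t \<in> S" for s t
    proof -
      have "N s u * N u t = M s u * M u t - M s u * v u * w t
          - v s * (w u * M u t) + v s * (w u * v u) * w t" for u
        by (simp add: N_def algebra_simps)
      hence "(\<Sum>u\<in>S. N s u * N u t) = (\<Sum>u\<in>S. M s u * M u t) - (\<Sum>u\<in>S. M s u * v u) * w t
          - v s * (\<Sum>u\<in>S. w u * M u t) + v s * (\<Sum>u\<in>S. w u * v u) * w t"
        by (simp add: sum.distrib sum_subtractf sum_distrib_left sum_distrib_right)
      also have "\<dots> = N s t" using that by (simp add: idem Mv wM wv N_def)
      finally show ?thesis .
    qed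
    moreover have "card {s\<in>S. \<exists>t\<in>S. N s t \<noteq> 0} < card {s\<in>S. \<exists>t\<in>S. M s t \<noteq> 0}"
    proof (rule psubset_card_mono)
      have row_a: "N a t = 0" for t using ab by (simp add: N_def v_def w_def)
      have "N s t = 0" if "\<forall>t\<in>S. M s t = 0" "t \<in> S" for s t
        using that ab by (simp add: N_def v_def)
      hence "{s\<in>S. \<exists>t\<in>S. N s t \<noteq> 0} \<subseteq> {s\<in>S. \<exists>t\<in>S. M s t \<noteq> 0}" by blast
      moreover have "a \<notin> {s\<in>S. \<exists>t\<in>S. N s t \<noteq> 0}" using row_a by simp
      moreover have "a \<in> {s\<in>S. \<exists>t\<in>S. M s t \<noteq> 0}" using ab by blast
      ultimately show "{s\<in>S. \<exists>t\<in>S. N s t \<noteq> 0} \<subset> {s\<in>S. \<exists>t\<in>S. M s t \<noteq> 0}" by blast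
    qed (use assms(1) in auto)
    ultimately have "(\<Sum>s\<in>S. N s s) \<in> \<nat>" using less.hyps by blast
    moreover have "(\<Sum>s\<in>S. M s s) = (\<Sum>s\<in>S. N s s) + 1"
      using wv by (simp add: N_def sum_subtractf mult.commute)
    ultimately show ?thesis by simp
  qed
qed

section \<open>The group algebra\<close>

locale finite_group = group G for G (structure) +
  assumes fin [simp]: "finite (carrier G)"
begin

lemma order_pos: "order G > 0"
  using fin order_gt_0_iff_finite by blast

lemma sum_mult_right:
  assumes "a \<in> carrier G"
  shows "(\<Sum>t\<in>carrier G. f (t \<otimes> a)) = (\<Sum>t\<in>carrier G. f t)"
  by (rule sum.reindex_bij_witness[of _ "\<lambda>t. t \<otimes> inv a" "\<lambda>t. t \<otimes> a"])
    (use assms in \<open>auto simp: m_assoc\<close>)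

lemma sum_mult_left:
  assumes "a \<in> carrier G"
  shows "(\<Sum>t\<in>carrier G. f (a \<otimes> t)) = (\<Sum>t\<in>carrier G. f t)"
  by (rule sum.reindex_bij_witness[of _ "\<lambda>t. inv a \<otimes> t" "\<lambda>t. a \<otimes> t"])
    (use assms in \<open>auto simp: m_assoc [symmetric]\<close>)

lemma sum_inv: "(\<Sum>t\<in>carrier G. f (inv t)) = (\<Sum>t\<in>carrier G. f t)"
  by (rule sum.reindex_bij_witness[of _ "\<lambda>t. inv t" "\<lambda>t. inv t"]) auto

text \<open>Elements of the group algebra are functions on the whole type that vanish off the
  carrier, so that equality of elements is equality of functions.\<close>

definition supported :: "('a \<Rightarrow> complex) \<Rightarrow> bool" where
  "supported x \<longleftrightarrow> (\<forall>u. u \<notin> carrier G \<longrightarrow> x u = 0)"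

text \<open>The product of the group algebra, written so that \<open>conv x y\<close> is the matrix
  [x(u t^-1)] of a Cayley colour graph applied to the vector y.\<close>

definition conv :: "('a \<Rightarrow> complex) \<Rightarrow> ('a \<Rightarrow> complex) \<Rightarrow> 'a \<Rightarrow> complex" where
  "conv x y = (\<lambda>u. if u \<in> carrier G then \<Sum>t\<in>carrier G. x (u \<otimes> inv t) * y t else 0)"

definition delta :: "'a \<Rightarrow> complex" where
  "delta u = (if u = \<one> then 1 else 0)"

text \<open>Convolution by \<open>star x\<close> is the adjoint of convolution by
  \<open>x\<close>.\<close>

definition star :: "('a \<Rightarrow> complex) \<Rightarrow> 'a \<Rightarrow> complex" where
  "star x = (\<lambda>u. if u \<in> carrier G then cnj (x (inv u)) else 0)"

definition central :: "('a \<Rightarrow> complex) \<Rightarrow> bool" where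
  "central x \<longleftrightarrow> (\<forall>u\<in>carrier G. \<forall>v\<in>carrier G. x (u \<otimes> v) = x (v \<otimes> u))"

lemma centralD: "central x \<Longrightarrow> u \<in> carrier G \<Longrightarrow> v \<in> carrier G \<Longrightarrow> x (u \<otimes> v) = x (v \<otimes> u)"
  by (simp add: central_def)

lemma supported_ext:
  "supported x \<Longrightarrow> supported y \<Longrightarrow> (\<And>u. u \<in> carrier G \<Longrightarrow> x u = y u) \<Longrightarrow> x = y"
  unfolding supported_def by (rule ext) metis

lemma supported_conv [simp]: "supported (conv x y)"
  and supported_delta [simp]: "supported delta"
  and supported_star [simp]: "supported (star x)"
  and supported_0 [simp]: "supported (\<lambda>_. 0)"
  by (auto simp: supported_def conv_def delta_def star_def)

lemma supported_lincomb [simp]: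
  "supported x \<Longrightarrow> supported y \<Longrightarrow> supported (\<lambda>u. c * x u + y u)"
  by (auto simp: supported_def)

lemma conv_assoc: "conv (conv x y) z = conv x (conv y z)"
proof (rule supported_ext)
  fix u assume u: "u \<in> carrier G"
  have "conv (conv x y) z u = (\<Sum>t\<in>carrier G. \<Sum>s\<in>carrier G. x (u \<otimes> inv t \<otimes> inv s) * y s * z t)"
    using u by (simp add: conv_def sum_distrib_right)
  \<comment> \<open>Right translation by \<open>inv t\<close> permutes the group, so s may be
    replaced by \<open>s \<otimes> inv t\<close>.\<close>
  also have "\<dots> = (\<Sum>t\<in>carrier G. \<Sum>s\<in>carrier G. x (u \<otimes> inv t \<otimes> inv (s \<otimes> inv t)) * y (s \<otimes> inv t) * z t)"
    by (rule sum.cong[OF refl], rule sum_mult_right[symmetric]) simp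
  also have "\<dots> = (\<Sum>t\<in>carrier G. \<Sum>s\<in>carrier G. x (u \<otimes> inv s) * y (s \<otimes> inv t) * z t)"
  proof (intro sum.cong refl)
    fix s t assume "s \<in> carrier G" "t \<in> carrier G"
    hence "u \<otimes> inv t \<otimes> inv (s \<otimes> inv t) = u \<otimes> inv s"
      using u by (simp add: inv_mult_group m_assoc) (simp add: m_assoc [symmetric])
    thus "x (u \<otimes> inv t \<otimes> inv (s \<otimes> inv t)) * y (s \<otimes> inv t) * z t = x (u \<otimes> inv s) * y (s \<otimes> inv t) * z t"
      by simp
  qed
  also have "\<dots> = conv x (conv y z) u"
    using u by (subst sum.swap) (simp add: conv_def sum_distrib_left mult.assoc)
  finally show "conv (conv x y) z u = conv x (conv y z) u" .
qed auto

lemma conv_delta_right [simp]: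
  assumes "supported x" shows "conv x delta = x"
proof (rule supported_ext)
  fix u assume u: "u \<in> carrier G"
  have "x (u \<otimes> inv t) * delta t = (if t = \<one> then x u else 0)" for t
    using u by (simp add: delta_def)
  thus "conv x delta u = x u" using u by (simp add: conv_def)
qed (use assms in auto)

lemma conv_delta_left [simp]:
  assumes "supported x" shows "conv delta x = x"
proof (rule supported_ext)
  fix u assume u: "u \<in> carrier G"
  have "conv delta x u = (\<Sum>t\<in>carrier G. if t = u then x u else 0)"
    unfolding conv_def if_P[OF u]
  proof (intro sum.cong refl)
    fix t assume t: "t \<in> carrier G"
    have "t = u" if "u \<otimes> inv t = \<one>"
      using inv_equality[OF that] t u by simp
    thus "delta (u \<otimes> inv t) * x t = (if t = u then x u else 0)"
      using u by (auto simp: delta_def)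
  qed
  thus "conv delta x u = x u" using u by simp
qed (use assms in auto)

lemma conv_lincomb_right: "conv x (\<lambda>u. c * y u + z u) = (\<lambda>u. c * conv x y u + conv x z u)"
  by (rule ext) (simp add: conv_def algebra_simps sum.distrib sum_distrib_left)

lemma conv_lincomb_left: "conv (\<lambda>u. c * x u + y u) z = (\<lambda>u. c * conv x z u + conv y z u)"
  by (rule ext) (simp add: conv_def algebra_simps sum.distrib sum_distrib_left)

lemma conv_0_left [simp]: "conv (\<lambda>_. 0) x = (\<lambda>_. 0)" and conv_0_right [simp]: "conv x (\<lambda>_. 0) = (\<lambda>_. 0)"
  by (auto simp: conv_def)

lemma conv_commute:
  assumes "central x" shows "conv x y = conv y x"
proof (rule supported_ext)
  fix u assume u: "u \<in> carrier G"
  \<comment> \<open>The substitution of \<open>inv t \<otimes> u\<close> for t moves the plain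
    argument t to y. Centrality then swaps the factors in the argument of x.\<close>
  have "conv y x u = (\<Sum>t\<in>carrier G. y (u \<otimes> inv (inv t \<otimes> u)) * x (inv t \<otimes> u))"
    using u sum_inv[of "\<lambda>t. y (u \<otimes> inv (t \<otimes> u)) * x (t \<otimes> u)"]
      sum_mult_right[of u "\<lambda>t. y (u \<otimes> inv t) * x t"] by (simp add: conv_def)
  also have "\<dots> = (\<Sum>t\<in>carrier G. x (u \<otimes> inv t) * y t)"
    using u by (intro sum.cong refl)
      (auto simp: inv_mult_group m_assoc [symmetric] centralD[OF assms])
  finally show "conv x y u = conv y x u" using u by (simp add: conv_def)
qed auto

lemma central_delta: "central delta"
  unfolding central_def delta_def by (metis inv_comm)

lemma central_lincomb: "central x \<Longrightarrow> central y \<Longrightarrow> central (\<lambda>u. c * x u + y u)"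
  by (auto simp: central_def)

lemma central_conv:
  assumes "central x" "central y" shows "central (conv x y)"
  unfolding central_def
proof (intro ballI)
  fix u v assume uv: "u \<in> carrier G" "v \<in> carrier G"
  \<comment> \<open>Substitute the conjugate of t by u, which leaves the values of y
    unchanged.\<close>
  have "conv x y (v \<otimes> u) = (\<Sum>t\<in>carrier G. x (v \<otimes> u \<otimes> inv (inv u \<otimes> t \<otimes> u)) * y (inv u \<otimes> t \<otimes> u))"
    using uv sum_mult_left[of "inv u" "\<lambda>t. x (v \<otimes> u \<otimes> inv (t \<otimes> u)) * y (t \<otimes> u)"]
      sum_mult_right[of u "\<lambda>t. x (v \<otimes> u \<otimes> inv t) * y t"] by (simp add: conv_def)
  also have "\<dots> = (\<Sum>t\<in>carrier G. x (u \<otimes> v \<otimes> inv t) * y t)"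
  proof (intro sum.cong refl)
    fix t assume t: "t \<in> carrier G"
    have "y (inv u \<otimes> t \<otimes> u) = y t"
      using uv t centralD[OF assms(2), of "inv u \<otimes> t" u] by (simp add: m_assoc [symmetric])
    moreover have "v \<otimes> u \<otimes> inv (inv u \<otimes> t \<otimes> u) = v \<otimes> inv t \<otimes> u"
    proof -
      have "v \<otimes> u \<otimes> inv (inv u \<otimes> t \<otimes> u) = v \<otimes> (u \<otimes> inv u) \<otimes> inv t \<otimes> u"
        using uv t by (simp only: inv_mult_group m_closed inv_closed inv_inv m_assoc)
      thus ?thesis using uv t by simp
    qed
    moreover have "x (v \<otimes> inv t \<otimes> u) = x (u \<otimes> v \<otimes> inv t)"
      using uv t centralD[OF assms(1), of "v \<otimes> inv t" u] by (simp add: m_assoc)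
    ultimately show "x (v \<otimes> u \<otimes> inv (inv u \<otimes> t \<otimes> u)) * y (inv u \<otimes> t \<otimes> u) = x (u \<otimes> v \<otimes> inv t) * y t"
      by simp
  qed
  finally show "conv x y (u \<otimes> v) = conv x y (v \<otimes> u)" using uv by (simp add: conv_def)
qed

lemma star_conv: "star (conv x y) = conv (star y) (star x)"
proof (rule supported_ext)
  fix u assume u: "u \<in> carrier G"
  have "conv (star y) (star x) u = (\<Sum>t\<in>carrier G. star y (u \<otimes> inv (t \<otimes> u)) * star x (t \<otimes> u))"
    using u sum_mult_right[of u "\<lambda>t. star y (u \<otimes> inv t) * star x t"] by (simp add: conv_def)
  also have "\<dots> = (\<Sum>t\<in>carrier G. cnj (y t) * cnj (x (inv u \<otimes> inv t)))"
    using u by (intro sum.cong refl) (auto simp: star_def inv_mult_group m_assoc [symmetric])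
  finally show "star (conv x y) u = conv (star y) (star x) u"
    using u by (simp add: conv_def star_def mult.commute)
qed auto

lemma star_star [simp]: "supported x \<Longrightarrow> star (star x) = x"
  by (rule ext) (auto simp: star_def supported_def)

lemma star_delta [simp]: "star delta = delta"
  by (rule ext) (auto simp: star_def delta_def)

lemma star_lincomb: "star (\<lambda>u. c * x u + y u) = (\<lambda>u. cnj c * star x u + star y u)"
  by (auto simp: star_def)

text \<open>Positive definiteness: the coefficient of \<open>conv (star x) x\<close> at the identity
  is the sum of the |x(t)|^2.\<close>

lemma star_conv_self_eq_0:
  assumes "supported x" "conv (star x) x = (\<lambda>_. 0)"
  shows "x = (\<lambda>_. 0)"
proof (rule supported_ext)
  have "0 = conv (star x) x \<one>" using assms by simp
  also have "\<dots> = (\<Sum>t\<in>carrier G. of_real ((cmod (x t))\<^sup>2))"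
    unfolding complex_norm_square by (auto simp: conv_def star_def mult.commute intro!: sum.cong)
  also have "\<dots> = of_real (\<Sum>t\<in>carrier G. (cmod (x t))\<^sup>2)" by simp
  finally have "(\<Sum>t\<in>carrier G. (cmod (x t))\<^sup>2) = 0" using of_real_eq_0_iff by metis
  thus "x u = 0" if "u \<in> carrier G" for u
    using that by (simp add: sum_nonneg_eq_0_iff)
qed (use assms in auto)

end

section \<open>Galois action on the values of central idempotents\<close>

lemma sum_periodic:
  fixes f :: "nat \<Rightarrow> 'c :: comm_ring_1"
  assumes "\<And>i. f (i + N) = f i"
  shows "(\<Sum>l<N. f (k + l)) = (\<Sum>l<N. f l)"
proof (induction k)
  case (Suc k)
  have "(\<Sum>l<N. f (Suc k + l)) + f k = (\<Sum>l<Suc N. f (k + l))"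
    by (subst sum.lessThan_Suc_shift) simp
  also have "\<dots> = (\<Sum>l<N. f (k + l)) + f k" using assms[of k] by simp
  finally show ?case using Suc by simp
qed simp

context finite_group
begin

text \<open>The element f = (1/N) (sum of w^k g^(-k) over k < N) is idempotent because w^N = 1 and
  g^N = 1. As e is central, x = f e is idempotent too, and the matrix [x(s t^-1)] has trace N x(1),
  which is the sum in question.\<close>

lemma fourier_coeff_idempotent_in_Nats:
  assumes e: "central e" "conv e e = e" and g: "g \<in> carrier G"
    and w: "w ^ order G = 1"
  shows "(\<Sum>k<order G. w ^ k * e (g [^] k)) \<in> \<nat>"
proof -
  define N where "N = order G"
  have N: "N > 0" using order_pos by (simp add: N_def)
  have gN: "g [^] N = \<one>" using g pow_order_eq_1 by (simp add: N_def)
  \<comment> \<open>\<open>F k\<close> is the element w^k g^(-k) e; these multiply by adding the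
    indices, which is \<open>FF\<close>.\<close>
  define F where "F k u = w ^ k * e (g [^] k \<otimes> u)" for k :: nat and u
  define x where "x u = (\<Sum>k<N. F k u) / of_nat N" for u
  have per: "F (k + N) u = F k u" for k u
    using g w gN by (simp add: F_def power_add N_def nat_pow_mult [symmetric])
  have FF: "(\<Sum>t\<in>carrier G. F k (s \<otimes> inv t) * F l (t \<otimes> inv u)) = F (k + l) (s \<otimes> inv u)"
    if su: "s \<in> carrier G" "u \<in> carrier G" for k l s u
  proof -
    \<comment> \<open>Centrality of e turns the second factor into e(t c); translating t by c then
      exposes the convolution of e with itself.\<close>
    define c where "c = inv u \<otimes> g [^] l"
    have c: "c \<in> carrier G" using su g by (simp add: c_def)
    have "(\<Sum>t\<in>carrier G. F k (s \<otimes> inv t) * F l (t \<otimes> inv u)) =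
        (\<Sum>t\<in>carrier G. w ^ (k + l) * (e (g [^] k \<otimes> s \<otimes> inv t) * e (t \<otimes> c)))"
    proof (intro sum.cong refl)
      fix t assume t: "t \<in> carrier G"
      have "e (g [^] l \<otimes> (t \<otimes> inv u)) = e (t \<otimes> c)"
        using centralD[OF e(1), of "g [^] l" "t \<otimes> inv u"] su g t by (simp add: c_def m_assoc)
      thus "F k (s \<otimes> inv t) * F l (t \<otimes> inv u) =
          w ^ (k + l) * (e (g [^] k \<otimes> s \<otimes> inv t) * e (t \<otimes> c))"
        using su g t by (simp add: F_def power_add m_assoc)
    qed
    also have "\<dots> = w ^ (k + l) * (\<Sum>t\<in>carrier G. e (g [^] k \<otimes> s \<otimes> c \<otimes> inv (t \<otimes> c)) * e (t \<otimes> c))"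
      unfolding sum_distrib_left
    proof (intro sum.cong refl)
      fix t assume t: "t \<in> carrier G"
      have "g [^] k \<otimes> s \<otimes> c \<otimes> inv (t \<otimes> c) = g [^] k \<otimes> s \<otimes> (c \<otimes> inv c) \<otimes> inv t"
        using su g t c by (simp only: inv_mult_group m_closed inv_closed m_assoc nat_pow_closed)
      thus "w ^ (k + l) * (e (g [^] k \<otimes> s \<otimes> inv t) * e (t \<otimes> c)) =
          w ^ (k + l) * (e (g [^] k \<otimes> s \<otimes> c \<otimes> inv (t \<otimes> c)) * e (t \<otimes> c))"
        using su g c by simp
    qed
    also have "\<dots> = w ^ (k + l) * conv e e (g [^] k \<otimes> s \<otimes> c)"
      using sum_mult_right[OF c, of "\<lambda>t. e (g [^] k \<otimes> s \<otimes> c \<otimes> inv t) * e t"] su g c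
      by (simp add: conv_def)
    also have "conv e e (g [^] k \<otimes> s \<otimes> c) = e (g [^] (k + l) \<otimes> (s \<otimes> inv u))"
      using centralD[OF e(1), of "g [^] k \<otimes> s \<otimes> inv u" "g [^] l"] su g
      by (simp add: e(2) c_def m_assoc nat_pow_mult [symmetric] add.commute[of k])
    finally show ?thesis by (simp add: F_def)
  qed
  have "(\<Sum>s\<in>carrier G. x (s \<otimes> inv s)) \<in> \<nat>"
  proof (rule trace_idempotent_in_Nats[where M = "\<lambda>s t. x (s \<otimes> inv t)"])
    fix s u assume su: "s \<in> carrier G" "u \<in> carrier G"
    have "(\<Sum>t\<in>carrier G. x (s \<otimes> inv t) * x (t \<otimes> inv u)) =
        (\<Sum>t\<in>carrier G. \<Sum>k<N. \<Sum>l<N. F k (s \<otimes> inv t) * F l (t \<otimes> inv u)) / of_nat N ^ 2"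
      by (simp add: x_def sum_product sum_divide_distrib power2_eq_square)
    also have "(\<Sum>t\<in>carrier G. \<Sum>k<N. \<Sum>l<N. F k (s \<otimes> inv t) * F l (t \<otimes> inv u)) =
        (\<Sum>k<N. \<Sum>l<N. \<Sum>t\<in>carrier G. F k (s \<otimes> inv t) * F l (t \<otimes> inv u))"
      by (subst sum.swap, intro sum.cong refl, subst sum.swap, rule refl)
    also have "\<dots> = (\<Sum>k<N. \<Sum>l<N. F (k + l) (s \<otimes> inv u))"
      using su by (simp add: FF)
    \<comment> \<open>By periodicity each k contributes the same inner sum, so one of the two
      factors 1/N cancels.\<close>
    also have "\<dots> = of_nat N * (\<Sum>l<N. F l (s \<otimes> inv u))"
      using sum_periodic[of "\<lambda>k. F k (s \<otimes> inv u)" N] per by simp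
    finally show "(\<Sum>t\<in>carrier G. x (s \<otimes> inv t) * x (t \<otimes> inv u)) = x (s \<otimes> inv u)"
      using N by (simp add: x_def power2_eq_square)
  qed simp
  also have "(\<Sum>s\<in>carrier G. x (s \<otimes> inv s)) = of_nat N * x \<one>"
    by (simp add: N_def Coset.order_def)
  also have "\<dots> = (\<Sum>k<N. w ^ k * e (g [^] k))"
    using N g by (simp add: x_def F_def)
  finally show ?thesis by (simp add: N_def)
qed

text \<open>Fourier inversion on Z/N, with the natural numbers \<open>m j\<close> as coefficients.
  The exponent \<open>j * (order G - 1)\<close> stands for -j, since zeta^N = 1.\<close>

lemma idempotent_power_expansion:
  assumes e: "central e" "conv e e = e" and g: "g \<in> carrier G"
  obtains m :: "nat \<Rightarrow> nat" where
    "\<And>l. of_nat (order G) * e (g [^] (l::nat)) =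
      (\<Sum>j<order G. of_nat (m j) * (zeta (order G) ^ l) ^ (j * (order G - 1)))"
proof -
  define N where "N = order G"
  define z where "z = zeta N"
  have N: "N > 0" using order_pos by (simp add: N_def)
  have gN: "g [^] N = \<one>" using g pow_order_eq_1 by (simp add: N_def)
  have zN: "z ^ N = 1" using N by (simp add: z_def)
  have "(\<Sum>k<N. (z ^ j) ^ k * e (g [^] k)) \<in> \<nat>" for j
    unfolding N_def
    by (rule fourier_coeff_idempotent_in_Nats[OF e g])
      (metis zN N_def mult.commute power_mult power_one)
  hence "\<forall>j. \<exists>m. (\<Sum>k<N. (z ^ j) ^ k * e (g [^] k)) = of_nat m" by (metis Nats_cases)
  then obtain m where m: "\<And>j. (\<Sum>k<N. (z ^ j) ^ k * e (g [^] k)) = of_nat (m j)" by metis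
  have "(\<Sum>j<N. of_nat (m j) * (z ^ l) ^ (j * (N - 1))) = of_nat N * e (g [^] l)" for l
  proof -
    \<comment> \<open>Modulo N the exponent k + l (N - 1) is k - l, so orthogonality of the roots of
      unity picks out k = l mod N.\<close>
    have dvd: "N dvd k + l * (N - 1) \<longleftrightarrow> k = l mod N" if "k < N" for k
    proof -
      have "int (k + l * (N - 1)) = (int k - int l) + int N * int l"
        using N by (cases N) (auto simp: algebra_simps)
      hence "N dvd k + l * (N - 1) \<longleftrightarrow> int N dvd (int k - int l) + int N * int l"
        by (metis int_dvd_int_iff)
      also have "\<dots> \<longleftrightarrow> int N dvd int k - int l" by (simp only: dvd_add_left_iff dvd_triv_left)
      also have "\<dots> \<longleftrightarrow> int k mod int N = int l mod int N" by (simp add: mod_eq_dvd_iff)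
      also have "\<dots> \<longleftrightarrow> k = l mod N" using that by (simp flip: of_nat_mod)
      finally show ?thesis .
    qed
    have "(\<Sum>j<N. of_nat (m j) * (z ^ l) ^ (j * (N - 1))) =
        (\<Sum>j<N. \<Sum>k<N. e (g [^] k) * (z ^ (k + l * (N - 1))) ^ j)"
      unfolding m [symmetric] sum_distrib_right
      by (intro sum.cong refl) (simp add: power_mult [symmetric] power_add [symmetric] algebra_simps)
    also have "\<dots> = (\<Sum>k<N. e (g [^] k) * (\<Sum>j<N. (z ^ (k + l * (N - 1))) ^ j))"
      by (subst sum.swap) (simp add: sum_distrib_left)
    also have "\<dots> = (\<Sum>k<N. if k = l mod N then of_nat N * e (g [^] k) else 0)"
    proof (intro sum.cong refl)
      fix k assume "k \<in> {..<N}"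
      hence k: "k < N" by simp
      show "e (g [^] k) * (\<Sum>j<N. (z ^ (k + l * (N - 1))) ^ j) =
          (if k = l mod N then of_nat N * e (g [^] k) else 0)"
        unfolding z_def sum_zeta_power[OF N] dvd[OF k] by simp
    qed
    also have "\<dots> = of_nat N * e (g [^] (l mod N))" using N by simp
    also have "g [^] (l mod N) = g [^] l"
    proof -
      have "g [^] (N * (l div N) + l mod N) = g [^] (l mod N)"
        using g gN by (simp only: nat_pow_mult [symmetric] nat_pow_pow [symmetric] nat_pow_one
            l_one nat_pow_closed)
      thus ?thesis by simp
    qed
    finally show ?thesis .
  qed
  thus ?thesis using that[of m] by (simp add: N_def z_def)
qed

lemma idempotent_value_in_cyclo_field:
  assumes "central e" "conv e e = e" "g \<in> carrier G"
  shows "e g \<in> cyclo_field (order G)"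
proof -
  interpret L: complex_subfield "cyclo_field (order G)" by (rule complex_subfield_cyclo_field)
  obtain m :: "nat \<Rightarrow> nat" where m: "\<And>l. of_nat (order G) * e (g [^] (l::nat)) =
      (\<Sum>j<order G. of_nat (m j) * (zeta (order G) ^ l) ^ (j * (order G - 1)))"
    using idempotent_power_expansion[OF assms] by blast
  have "of_nat (order G) * e (g [^] (1::nat)) \<in> cyclo_field (order G)"
    unfolding m by (intro L.sum_mem L.mult_mem L.of_nat_mem L.power_mem zeta_in_cyclo_field)
  from L.divide_mem[OF this L.of_nat_mem[of "order G"]] show ?thesis
    using order_pos assms(3) by simp
qed

text \<open>Apply the automorphism to the expansion at l = 1: the natural coefficients are fixed and
  zeta becomes zeta^h, which is the expansion at l = h.\<close>

lemma aut_idempotent_value: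
  assumes e: "central e" "conv e e = e" and g: "g \<in> carrier G"
    and aut: "field_aut (cyclo_field (order G)) \<sigma>" and zeta_h: "\<sigma> (zeta (order G)) = zeta (order G) ^ h"
  shows "\<sigma> (e g) = e (g [^] h)"
proof -
  interpret cyclo_aut "order G" \<sigma> using aut order_pos by unfold_locales
  let ?N = "order G"
  obtain m :: "nat \<Rightarrow> nat" where m: "\<And>l. of_nat ?N * e (g [^] (l::nat)) =
      (\<Sum>j<?N. of_nat (m j) * (zeta ?N ^ l) ^ (j * (?N - 1)))"
    using idempotent_power_expansion[OF e g] by blast
  have "of_nat ?N * \<sigma> (e g) = \<sigma> (of_nat ?N * e g)"
    by (simp add: aut_mult aut_of_nat L.of_nat_mem idempotent_value_in_cyclo_field e g)
  also have "of_nat ?N * e g = (\<Sum>j<?N. of_nat (m j) * zeta ?N ^ (j * (?N - 1)))"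
    using m[of 1] g by simp
  also have "\<sigma> \<dots> = (\<Sum>j<?N. of_nat (m j) * (zeta ?N ^ h) ^ (j * (?N - 1)))"
    by (simp add: aut_sum aut_mult aut_of_nat aut_power zeta_h L.mult_mem L.of_nat_mem L.power_mem
        zeta_in_cyclo_field)
  also have "\<dots> = of_nat ?N * e (g [^] h)" by (simp add: m)
  finally show ?thesis using order_pos by simp
qed

end

section \<open>Spectral decomposition of a Cayley colour graph\<close>

locale cayley = finite_group +
  fixes \<alpha> :: "'a \<Rightarrow> rat"
  assumes class_fun: "class_function G \<alpha>"
    and symmetric: "\<forall>g\<in>carrier G. \<alpha> g = \<alpha> (inv g)"
begin

section \<open>The group algebra element of \<open>\<alpha>\<close> and polynomials in it\<close>

definition elt :: "'a \<Rightarrow> complex" where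
  "elt u = (if u \<in> carrier G then of_rat (\<alpha> u) else 0)"

lemma supported_elt [simp]: "supported elt"
  by (simp add: supported_def elt_def)

lemma central_elt: "central elt"
  unfolding central_def
proof (intro ballI)
  fix u v assume uv: "u \<in> carrier G" "v \<in> carrier G"
  have "v \<otimes> (u \<otimes> v) \<otimes> inv v = v \<otimes> u"
    using uv by (simp add: m_assoc)
  hence "\<alpha> (u \<otimes> v) = \<alpha> (v \<otimes> u)"
    using class_fun uv unfolding class_function_def by (metis m_closed)
  thus "elt (u \<otimes> v) = elt (v \<otimes> u)" using uv by (simp add: elt_def)
qed

lemma star_elt: "star elt = elt"
proof
  have cnj_of_rat: "cnj (of_rat r) = of_rat r" for r :: rat
    by (cases r) (simp add: of_rat_rat)
  have "\<alpha> (inv u) = \<alpha> u" if "u \<in> carrier G" for u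
    using bspec[OF symmetric that] by (rule sym)
  thus "star elt u = elt u" for u by (simp add: star_def elt_def cnj_of_rat)
qed

text \<open>Horner evaluation of p at \<open>elt\<close>, with \<open>conv\<close> as product and
  \<open>delta\<close> as unit.\<close>

definition peval :: "complex poly \<Rightarrow> 'a \<Rightarrow> complex" where
  "peval p = fold_coeffs (\<lambda>c x u. c * delta u + conv elt x u) p (\<lambda>_. 0)"

lemma peval_0 [simp]: "peval 0 = (\<lambda>_. 0)"
  by (simp add: peval_def)

lemma peval_pCons: "peval (pCons c p) = (\<lambda>u. c * delta u + conv elt (peval p) u)"
  by (cases "c = 0 \<and> p = 0") (auto simp: peval_def)

lemma supported_peval [simp]: "supported (peval p)"
  by (induction p) (simp_all add: peval_pCons)

lemma central_peval: "central (peval p)"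
  by (induction p)
    (simp_all add: peval_pCons central_lincomb central_delta central_conv central_elt central_def [of "\<lambda>_. 0"])

lemma peval_lincomb: "peval (smult c p + q) = (\<lambda>u. c * peval p u + peval q u)"
proof (induction p q rule: poly_induct2)
  case (pCons a p b q)
  have "peval (smult c (pCons a p) + pCons b q) = peval (pCons (c * a + b) (smult c p + q))"
    by simp
  also have "\<dots> = (\<lambda>u. c * peval (pCons a p) u + peval (pCons b q) u)"
    by (simp only: peval_pCons pCons conv_lincomb_right) (simp add: algebra_simps)
  finally show ?case .
qed simp

lemma peval_smult: "peval (smult c p) = (\<lambda>u. c * peval p u)"
  using peval_lincomb[of c p 0] by simp

lemma peval_add: "peval (p + q) = (\<lambda>u. peval p u + peval q u)"
  using peval_lincomb[of 1 p q] by simp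

lemma peval_diff: "peval (p - q) = (\<lambda>u. peval p u - peval q u)"
  using peval_lincomb[of "- 1" q p] by simp

lemma peval_sum: "peval (\<Sum>i\<in>I. f i) = (\<lambda>u. \<Sum>i\<in>I. peval (f i) u)"
  by (induction I rule: infinite_finite_induct) (simp_all add: peval_add)

lemma peval_mult: "peval (p * q) = conv (peval p) (peval q)"
proof (induction p)
  case (pCons c p)
  have "peval (pCons c p * q) = (\<lambda>u. c * peval q u + peval (pCons 0 (p * q)) u)"
    by (simp only: mult_pCons_left peval_lincomb)
  also have "\<dots> = (\<lambda>u. c * peval q u + conv elt (conv (peval p) (peval q)) u)"
    by (simp add: peval_pCons pCons)
  also have "\<dots> = conv (peval (pCons c p)) (peval q)"
    by (simp add: peval_pCons conv_lincomb_left conv_assoc)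
  finally show ?case .
qed simp

lemma peval_X: "peval [:0, 1:] = elt"
proof -
  have "(\<lambda>u. 1 * delta u + 0) = delta" by simp
  thus ?thesis by (simp add: peval_pCons)
qed

text \<open>Since \<open>elt\<close> is self-adjoint, it suffices to conjugate the
  coefficients.\<close>

lemma star_peval: "\<exists>q. star (peval p) = peval q"
proof (induction p)
  case 0
  show ?case by (intro exI[of _ 0]) (auto simp: star_def)
next
  case (pCons c p)
  then obtain q where q: "star (peval p) = peval q" by blast
  have "star (peval (pCons c p)) = (\<lambda>u. cnj c * delta u + conv (peval q) elt u)"
    by (simp add: peval_pCons star_lincomb star_conv star_elt q)
  also have "\<dots> = peval (pCons (cnj c) q)"
    by (simp add: peval_pCons conv_commute[OF central_elt])
  finally show ?case by blast
qed

text \<open>Let a = p(elt) with a^2 = 0, and let b be its adjoint. Polynomials in \<open>elt\<close>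
  commute, so b a is self-adjoint with square b^2 a^2 = 0. Definiteness gives b a = 0, and once more
  a = 0.\<close>

lemma peval_square_eq_0:
  assumes "peval (p * p) = (\<lambda>_. 0)" shows "peval p = (\<lambda>_. 0)"
proof -
  obtain q where q: "star (peval p) = peval q" using star_peval by blast
  have qp: "star (peval q) = peval p" by (simp flip: q)
  have "conv (star (peval (q * p))) (peval (q * p)) = peval ((q * p) * (q * p))"
    by (simp add: peval_mult star_conv q qp)
  also have "\<dots> = conv (peval (q * q)) (peval (p * p))"
    unfolding peval_mult [symmetric] by (simp add: mult_ac)
  also have "\<dots> = (\<lambda>_. 0)" by (simp add: assms)
  finally have "peval (q * p) = (\<lambda>_. 0)" by (rule star_conv_self_eq_0[OF supported_peval])
  hence "conv (star (peval p)) (peval p) = (\<lambda>_. 0)" by (simp add: q peval_mult)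
  thus ?thesis by (rule star_conv_self_eq_0[OF supported_peval])
qed

lemma peval_power_eq_0:
  assumes "peval (p ^ k) = (\<lambda>_. 0)" shows "peval p = (\<lambda>_. 0)"
proof -
  have two: "peval p = (\<lambda>_. 0)" if "peval (p ^ (2 ^ i)) = (\<lambda>_. 0)" for i
    using that
  proof (induction i)
    case (Suc i)
    have "p ^ (2 ^ Suc i) = p ^ (2 ^ i) * p ^ (2 ^ i)"
      by (simp only: power_Suc mult_2 power_add)
    thus ?case using Suc peval_square_eq_0[of "p ^ (2 ^ i)"] by simp
  qed simp
  \<comment> \<open>Since k < 2^k, the exponent may be raised to a power of two, where squares can
    be removed one at a time.\<close>
  have "p ^ (2 ^ k) = p ^ (2 ^ k - k) * p ^ k"
    by (simp only: power_add [symmetric] le_add_diff_inverse2[OF less_imp_le[OF less_exp]])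
  thus ?thesis using assms two[of k] by (simp add: peval_mult)
qed

lemma exists_annihilator: "\<exists>q. q \<noteq> 0 \<and> peval q = (\<lambda>_. 0)"
proof -
  \<comment> \<open>The powers of \<open>elt\<close> with exponents 0 to |G| number |G| + 1, one
    more than the coordinates, so they are linearly dependent.\<close>
  obtain c where c: "\<exists>i\<in>{..card (carrier G)}. c i \<noteq> 0"
      "\<And>u. u \<in> carrier G \<Longrightarrow> (\<Sum>i\<le>card (carrier G). peval (monom 1 i) u * c i) = 0"
    using homogeneous_system_nontrivial_solution
      [of "carrier G" "{..card (carrier G)}" "\<lambda>u i. peval (monom 1 i) u"] by auto
  define q where "q = (\<Sum>i\<le>card (carrier G). smult (c i) (monom 1 i))"
  have "peval q = (\<lambda>_. 0)"
  proof (rule supported_ext)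
    show "peval q u = 0" if "u \<in> carrier G" for u
      using c(2)[OF that] by (simp add: q_def peval_sum peval_smult mult.commute)
  qed auto
  moreover have "coeff q i = c i" if "i \<le> card (carrier G)" for i
    using that by (simp add: q_def coeff_sum if_distrib[of "(*) _"] sum.delta cong: if_cong)
  hence "q \<noteq> 0" using c(1) by (metis atMost_iff coeff_0)
  ultimately show ?thesis by blast
qed

section \<open>Eigenvalues and annihilating polynomials\<close>

lemma eigenvectorE:
  assumes "cay_eigenvalue G \<alpha> \<mu>"
  obtains v where "supported v" "v \<noteq> (\<lambda>_. 0)" "conv elt v = (\<lambda>u. \<mu> * v u)"
proof -
  obtain v g where v: "g \<in> carrier G" "v g \<noteq> 0"
      "\<forall>g\<in>carrier G. (\<Sum>h\<in>carrier G. of_rat (\<alpha> (g \<otimes> inv h)) * v h) = \<mu> * v g"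
    using assms by (auto simp: cay_eigenvalue_def)
  define w where "w u = (if u \<in> carrier G then v u else 0)" for u
  have "conv elt w = (\<lambda>u. \<mu> * w u)"
    using v(3) by (auto simp: conv_def w_def elt_def)
  moreover have "supported w" by (simp add: supported_def w_def)
  moreover have "w \<noteq> (\<lambda>_. 0)" using v by (metis w_def)
  ultimately show ?thesis using that by blast
qed

lemma eigenvalueI:
  assumes "supported v" "v \<noteq> (\<lambda>_. 0)" "conv elt v = (\<lambda>u. \<mu> * v u)"
  shows "cay_eigenvalue G \<alpha> \<mu>"
  unfolding cay_eigenvalue_def
proof (intro exI[of _ v] conjI ballI)
  obtain g where "v g \<noteq> 0" using assms(2) by (auto simp: fun_eq_iff)
  thus "\<exists>g\<in>carrier G. v g \<noteq> 0" using assms(1) by (auto simp: supported_def)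
  show "(\<Sum>h\<in>carrier G. of_rat (\<alpha> (g \<otimes> inv h)) * v h) = \<mu> * v g" if "g \<in> carrier G" for g
    using fun_cong[OF assms(3), of g] that by (simp add: conv_def elt_def)
qed

lemma peval_eigenvector:
  assumes "supported v" "conv elt v = (\<lambda>u. \<mu> * v u)"
  shows "conv (peval p) v = (\<lambda>u. poly p \<mu> * v u)"
proof (induction p)
  case (pCons c p)
  have "conv elt (\<lambda>u. poly p \<mu> * v u) = (\<lambda>u. poly p \<mu> * (\<mu> * v u))"
    using conv_lincomb_right[of elt "poly p \<mu>" v "\<lambda>_. 0"] assms(2) by simp
  thus ?case
    using assms(1) by (simp add: peval_pCons conv_lincomb_left conv_assoc pCons algebra_simps)
qed simp

lemma poly_annihilator_eigenvalue:
  assumes "peval q = (\<lambda>_. 0)" "cay_eigenvalue G \<alpha> \<mu>"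
  shows "poly q \<mu> = 0"
proof -
  obtain v where v: "supported v" "v \<noteq> (\<lambda>_. 0)" "conv elt v = (\<lambda>u. \<mu> * v u)"
    using eigenvectorE[OF assms(2)] .
  have "(\<lambda>u. poly q \<mu> * v u) = (\<lambda>_. 0)"
    using peval_eigenvector[OF v(1,3), of q] assms(1) by simp
  thus ?thesis using v(2) by (metis mult_eq_0_iff)
qed

lemma finite_eigenvalues: "finite {\<mu>. cay_eigenvalue G \<alpha> \<mu>}"
proof -
  obtain q where q: "q \<noteq> 0" "peval q = (\<lambda>_. 0)" using exists_annihilator by blast
  show ?thesis
    by (rule finite_subset[OF _ poly_roots_finite[OF q(1)]])
      (use poly_annihilator_eigenvalue[OF q(2)] in auto)
qed

text \<open>The roots of a minimal annihilator \<open>q\<close> are eigenvalues, so \<open>q\<close> divides a power of \<open>f\<close>;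
  and the subalgebra generated by a self-adjoint element is reduced.\<close>

lemma peval_eq_0_of_vanishing:
  assumes "\<And>\<mu>. cay_eigenvalue G \<alpha> \<mu> \<Longrightarrow> poly f \<mu> = 0"
  shows "peval f = (\<lambda>_. 0)"
proof -
  define P where "P q \<longleftrightarrow> q \<noteq> 0 \<and> peval q = (\<lambda>_. 0)" for q
  obtain q where q: "P q" "\<And>r. P r \<Longrightarrow> degree q \<le> degree r"
    using exists_annihilator ex_has_least_nat[of P _ degree] by (auto simp: P_def)
  have "cay_eigenvalue G \<alpha> \<mu>" if root: "poly q \<mu> = 0" for \<mu>
  proof -
    \<comment> \<open>By minimality r(elt) is nonzero, and elt - \<mu> kills it, so r(elt) is itself
      an eigenvector.\<close>
    obtain r where r: "q = [:- \<mu>, 1:] * r" using root by (auto simp: poly_eq_0_iff_dvd dvd_def)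
    have "r \<noteq> 0" using q(1) r by (auto simp: P_def)
    hence "degree q = Suc (degree r)" unfolding r by (subst degree_mult_eq) auto
    hence "peval r \<noteq> (\<lambda>_. 0)" using q(2)[of r] \<open>r \<noteq> 0\<close> by (auto simp: P_def)
    moreover have "conv elt (peval r) = (\<lambda>u. \<mu> * peval r u)"
    proof -
      have "[:0, 1:] * r = smult \<mu> r + q" by (simp add: r algebra_simps)
      hence "peval ([:0, 1:] * r) = (\<lambda>u. \<mu> * peval r u)"
        using q(1) by (simp only: peval_lincomb) (simp add: P_def)
      thus ?thesis by (simp only: peval_mult peval_X)
    qed
    ultimately show ?thesis by (intro eigenvalueI) auto
  qed
  hence "q dvd f ^ degree q"
    using nullstellensatz_univariate[of q f] assms q(1) by (auto simp: P_def)
  then obtain r where "f ^ degree q = q * r" by (auto simp: dvd_def)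
  hence "peval (f ^ degree q) = (\<lambda>_. 0)" using q(1) by (simp add: peval_mult P_def)
  thus ?thesis by (rule peval_power_eq_0)
qed

text \<open>Identities between polynomials in \<open>elt\<close> may be checked on the eigenvalues;
  the relations between the idempotents below all arise in this way.\<close>

lemma peval_cong:
  assumes "\<And>\<mu>. cay_eigenvalue G \<alpha> \<mu> \<Longrightarrow> poly f \<mu> = poly g \<mu>"
  shows "peval f = peval g"
  using peval_eq_0_of_vanishing[of "f - g"] assms by (auto simp: peval_diff fun_eq_iff)

section \<open>Spectral idempotents\<close>

definition lagrange :: "complex \<Rightarrow> complex poly" where
  "lagrange \<mu> = (\<Prod>\<nu>\<in>{\<nu>. cay_eigenvalue G \<alpha> \<nu>} - {\<mu>}. smult (1 / (\<mu> - \<nu>)) [:- \<nu>, 1:])"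

lemma poly_lagrange:
  assumes "cay_eigenvalue G \<alpha> \<nu>"
  shows "poly (lagrange \<mu>) \<nu> = (if \<nu> = \<mu> then 1 else 0)"
proof (cases "\<nu> = \<mu>")
  case True
  thus ?thesis
    by (auto simp: lagrange_def poly_prod simp flip: diff_divide_distrib intro!: prod.neutral
        split: if_splits)
next
  case False
  hence "\<exists>\<kappa>\<in>{\<nu>. cay_eigenvalue G \<alpha> \<nu>} - {\<mu>}. poly (smult (1 / (\<mu> - \<kappa>)) [:- \<kappa>, 1:]) \<nu> = 0"
    using assms by (intro bexI[of _ \<nu>]) auto
  thus ?thesis using False finite_eigenvalues by (simp only: lagrange_def poly_prod) (simp add: prod_zero)
qed

text \<open>The spectral projection for \<mu>. It is zero if \<mu> is not an eigenvalue, so the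
  idempotent laws hold for every \<mu>.\<close>

definition idem :: "complex \<Rightarrow> 'a \<Rightarrow> complex" where
  "idem \<mu> = peval (lagrange \<mu>)"

lemma central_idem: "central (idem \<mu>)"
  by (simp add: idem_def central_peval)

lemma conv_idem_idem: "conv (idem \<mu>) (idem \<mu>) = idem \<mu>"
  unfolding idem_def peval_mult [symmetric] by (rule peval_cong) (simp add: poly_lagrange)

lemma conv_elt_idem: "conv elt (idem \<mu>) = (\<lambda>u. \<mu> * idem \<mu> u)"
proof -
  have "peval ([:0, 1:] * lagrange \<mu>) = peval (smult \<mu> (lagrange \<mu>))"
    by (rule peval_cong) (simp add: poly_lagrange)
  thus ?thesis by (simp only: peval_mult peval_X idem_def peval_smult)
qed

lemma elt_eq_sum_idem: "elt u = (\<Sum>\<mu> | cay_eigenvalue G \<alpha> \<mu>. \<mu> * idem \<mu> u)"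
proof -
  have "peval [:0, 1:] = peval (\<Sum>\<mu> | cay_eigenvalue G \<alpha> \<mu>. smult \<mu> (lagrange \<mu>))"
    by (rule peval_cong) (simp add: poly_sum poly_lagrange if_distrib[of "(*) _"] finite_eigenvalues cong: if_cong)
  thus ?thesis by (simp only: peval_X peval_sum peval_smult idem_def)
qed

lemma conv_idem_idem_distinct:
  assumes "\<mu> \<noteq> \<nu>" shows "conv (idem \<mu>) (idem \<nu>) = (\<lambda>_. 0)"
proof -
  have "peval (lagrange \<mu> * lagrange \<nu>) = peval 0"
    by (rule peval_cong) (use assms in \<open>simp add: poly_lagrange\<close>)
  thus ?thesis by (simp add: idem_def peval_mult)
qed

text \<open>The idempotent acts as the identity on an eigenvector for \<mu>.\<close>

lemma idem_nonzero:
  assumes "cay_eigenvalue G \<alpha> \<mu>"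
  obtains u where "u \<in> carrier G" "idem \<mu> u \<noteq> 0"
proof -
  obtain v where v: "supported v" "v \<noteq> (\<lambda>_. 0)" "conv elt v = (\<lambda>u. \<mu> * v u)"
    using eigenvectorE[OF assms] .
  have "conv (idem \<mu>) v = v"
    using peval_eigenvector[OF v(1,3), of "lagrange \<mu>"] assms by (simp add: idem_def poly_lagrange)
  hence "idem \<mu> \<noteq> (\<lambda>_. 0)" using v(2) by auto
  then obtain u where u: "idem \<mu> u \<noteq> 0" by (auto simp: fun_eq_iff)
  moreover have "u \<in> carrier G"
    using u supported_peval[of "lagrange \<mu>"] by (auto simp: idem_def supported_def)
  ultimately show ?thesis using that by blast
qed

lemma idem_in_cyclo_field: "u \<in> carrier G \<Longrightarrow> idem \<mu> u \<in> cyclo_field (order G)"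
  by (rule idempotent_value_in_cyclo_field[OF central_idem conv_idem_idem])

lemma elt_in_cyclo_field: "elt u \<in> cyclo_field (order G)"
  using complex_subfield.of_rat_mem[OF complex_subfield_cyclo_field]
    complex_subfield.zero_mem[OF complex_subfield_cyclo_field] by (simp add: elt_def)

text \<open>At a point u where the idempotent e does not vanish, \<mu> is the quotient of
  \<open>conv elt e\<close> at u by e(u), and both lie in the field.\<close>

lemma eigenvalue_in_cyclo_field:
  assumes "cay_eigenvalue G \<alpha> \<mu>" shows "\<mu> \<in> cyclo_field (order G)"
proof -
  interpret L: complex_subfield "cyclo_field (order G)" by (rule complex_subfield_cyclo_field)
  obtain u where u: "u \<in> carrier G" "idem \<mu> u \<noteq> 0" using idem_nonzero[OF assms] .
  have "conv elt (idem \<mu>) u \<in> cyclo_field (order G)"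
    using u by (auto simp: conv_def intro!: L.sum_mem L.mult_mem elt_in_cyclo_field idem_in_cyclo_field)
  hence "\<mu> * idem \<mu> u \<in> cyclo_field (order G)" by (simp add: conv_elt_idem)
  from L.divide_mem[OF this idem_in_cyclo_field[OF u(1), of \<mu>]] show ?thesis using u(2) by simp
qed

section \<open>Galois action on the eigenvalues\<close>

text \<open>The automorphism sends each c(\<mu>) to \<mu> and e(u) to e(u^h), so the sum becomes the
  spectral decomposition at u^h. It serves with c the identity and with c a choice of
  preimages.\<close>

lemma aut_elt:
  assumes aut: "field_aut (cyclo_field (order G)) \<sigma>" and zeta_h: "\<sigma> (zeta (order G)) = zeta (order G) ^ h"
    and c: "\<And>\<mu>. cay_eigenvalue G \<alpha> \<mu> \<Longrightarrow> c \<mu> \<in> cyclo_field (order G) \<and> \<sigma> (c \<mu>) = \<mu>"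
    and u: "u \<in> carrier G"
  shows "elt (u [^] h) = \<sigma> (\<Sum>\<mu> | cay_eigenvalue G \<alpha> \<mu>. c \<mu> * idem \<mu> u)"
proof -
  interpret cyclo_aut "order G" \<sigma> using aut order_pos by unfold_locales
  have "\<sigma> (\<Sum>\<mu> | cay_eigenvalue G \<alpha> \<mu>. c \<mu> * idem \<mu> u) =
      (\<Sum>\<mu> | cay_eigenvalue G \<alpha> \<mu>. \<mu> * idem \<mu> (u [^] h))"
    by (subst aut_sum) (use c u in \<open>auto simp: aut_mult L.mult_mem idem_in_cyclo_field
        aut_idempotent_value[OF central_idem conv_idem_idem u aut zeta_h] intro!: sum.cong\<close>)
  thus ?thesis by (simp add: elt_eq_sum_idem)
qed

lemma power_invariant_iff_eigenvalues_fixed: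
  assumes aut: "field_aut (cyclo_field (order G)) \<sigma>" and zeta_h: "\<sigma> (zeta (order G)) = zeta (order G) ^ h"
  shows "(\<forall>g\<in>carrier G. \<alpha> (g [^] h) = \<alpha> g) \<longleftrightarrow> (\<forall>\<mu>. cay_eigenvalue G \<alpha> \<mu> \<longrightarrow> \<sigma> \<mu> = \<mu>)"
proof
  interpret cyclo_aut "order G" \<sigma> using aut order_pos by unfold_locales
  assume fixed: "\<forall>\<mu>. cay_eigenvalue G \<alpha> \<mu> \<longrightarrow> \<sigma> \<mu> = \<mu>"
  show "\<forall>g\<in>carrier G. \<alpha> (g [^] h) = \<alpha> g"
  proof
    fix g assume g: "g \<in> carrier G"
    have "elt (g [^] h) = \<sigma> (elt g)"
      using aut_elt[OF aut zeta_h _ g, of "\<lambda>\<mu>. \<mu>"] fixed eigenvalue_in_cyclo_field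
      by (simp add: elt_eq_sum_idem)
    thus "\<alpha> (g [^] h) = \<alpha> g" using g by (simp add: elt_def aut_of_rat)
  qed
next
  interpret cyclo_aut "order G" \<sigma> using aut order_pos by unfold_locales
  let ?E = "{\<mu>. cay_eigenvalue G \<alpha> \<mu>}"
  assume inv: "\<forall>g\<in>carrier G. \<alpha> (g [^] h) = \<alpha> g"
  have "\<forall>\<mu>\<in>?E. \<exists>\<nu>\<in>cyclo_field (order G). \<sigma> \<nu> = \<mu>"
    using aut_image eigenvalue_in_cyclo_field by (metis imageE mem_Collect_eq)
  then obtain c where c: "\<And>\<mu>. \<mu> \<in> ?E \<Longrightarrow> c \<mu> \<in> cyclo_field (order G) \<and> \<sigma> (c \<mu>) = \<mu>" by metis
  \<comment> \<open>Invariance of \<open>\<alpha>\<close> gives \<open>elt\<close> a second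
    decomposition, with coefficients c(\<mu>) in place of \<mu>.\<close>
  have eq: "elt u = (\<Sum>\<mu>\<in>?E. c \<mu> * idem \<mu> u)" if u: "u \<in> carrier G" for u
  proof (rule inj_onD[OF aut_inj])
    have "\<sigma> (\<Sum>\<mu>\<in>?E. c \<mu> * idem \<mu> u) = elt (u [^] h)"
      using aut_elt[OF aut zeta_h _ u, of c] c by simp
    also have "\<dots> = \<sigma> (elt u)" using inv u by (simp add: elt_def aut_of_rat)
    finally show "\<sigma> (elt u) = \<sigma> (\<Sum>\<mu>\<in>?E. c \<mu> * idem \<mu> u)" by simp
    show "(\<Sum>\<mu>\<in>?E. c \<mu> * idem \<mu> u) \<in> cyclo_field (order G)"
      using c u by (intro L.sum_mem L.mult_mem idem_in_cyclo_field) auto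
  qed (rule elt_in_cyclo_field)
  show "\<forall>\<mu>. cay_eigenvalue G \<alpha> \<mu> \<longrightarrow> \<sigma> \<mu> = \<mu>"
  proof (intro allI impI)
    fix \<mu> assume \<mu>: "cay_eigenvalue G \<alpha> \<mu>"
    obtain u where u: "u \<in> carrier G" "idem \<mu> u \<noteq> 0" using idem_nonzero[OF \<mu>] .
    \<comment> \<open>Multiplying the second decomposition by the idempotent of \<mu> isolates
      c(\<mu>), which must therefore equal \<mu>.\<close>
    have "\<mu> * idem \<mu> u = conv elt (idem \<mu>) u" by (simp add: conv_elt_idem)
    also have "\<dots> = (\<Sum>t\<in>carrier G. \<Sum>\<nu>\<in>?E. c \<nu> * (idem \<nu> (u \<otimes> inv t) * idem \<mu> t))"
      using u by (simp add: conv_def eq sum_distrib_right mult.assoc)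
    also have "\<dots> = (\<Sum>\<nu>\<in>?E. c \<nu> * conv (idem \<nu>) (idem \<mu>) u)"
      using u by (subst sum.swap) (simp add: conv_def sum_distrib_left)
    also have "\<dots> = (\<Sum>\<nu>\<in>?E. if \<nu> = \<mu> then c \<mu> * idem \<mu> u else 0)"
      by (intro sum.cong refl) (auto simp: conv_idem_idem conv_idem_idem_distinct)
    also have "\<dots> = c \<mu> * idem \<mu> u" using \<mu> finite_eigenvalues by simp
    finally have "c \<mu> = \<mu>" using u by simp
    thus "\<sigma> \<mu> = \<mu>" using c[of \<mu>] \<mu> by simp
  qed
qed

text \<open>Every automorphism over \<open>K\<close> is described by some h in
  \<open>H_field\<close>, so equality of the two sets says that all of them fix all eigenvalues; by
  the Galois correspondence these then lie in \<open>K\<close>.\<close>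

lemma eigenvalues_in_subfield_iff:
  assumes K: "is_subfield K" "K \<subseteq> cyclo_field (order G)"
  shows "(\<forall>\<mu>. cay_eigenvalue G \<alpha> \<mu> \<longrightarrow> \<mu> \<in> K) \<longleftrightarrow> H_fun G \<alpha> K = H_field (order G) K"
proof
  assume in_K: "\<forall>\<mu>. cay_eigenvalue G \<alpha> \<mu> \<longrightarrow> \<mu> \<in> K"
  have "\<forall>g\<in>carrier G. \<alpha> (g [^] h) = \<alpha> g" if h: "h \<in> H_field (order G) K" for h
  proof -
    obtain \<sigma> where \<sigma>: "\<sigma> \<in> galois_group (order G) K" "\<sigma> (zeta (order G)) = zeta (order G) ^ h"
      using h by (auto simp: H_field_def)
    thus ?thesis
      using power_invariant_iff_eigenvalues_fixed[of \<sigma> h] in_K by (auto simp: galois_group_def)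
  qed
  thus "H_fun G \<alpha> K = H_field (order G) K" by (auto simp: H_fun_def)
next
  assume eq: "H_fun G \<alpha> K = H_field (order G) K"
  show "\<forall>\<mu>. cay_eigenvalue G \<alpha> \<mu> \<longrightarrow> \<mu> \<in> K"
  proof (intro allI impI)
    fix \<mu> assume \<mu>: "cay_eigenvalue G \<alpha> \<mu>"
    show "\<mu> \<in> K"
    proof (rule fixed_by_galois_group_imp_mem[OF order_pos K eigenvalue_in_cyclo_field[OF \<mu>]])
      fix \<sigma> assume \<sigma>: "\<sigma> \<in> galois_group (order G) K"
      then interpret cyclo_aut "order G" \<sigma>
        by unfold_locales (auto simp: galois_group_def order_pos)
      obtain h where h: "h \<in> units_mod (order G)" "\<sigma> (zeta (order G)) = zeta (order G) ^ h"
        using aut_zeta .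
      hence "h \<in> H_fun G \<alpha> K" using \<sigma> eq by (auto simp: H_field_def)
      thus "\<sigma> \<mu> = \<mu>"
        using power_invariant_iff_eigenvalues_fixed[OF aut h(2)] \<mu> by (auto simp: H_fun_def)
    qed
  qed
qed

end

theorem mainTheorem17:
  fixes G :: "('a, 'b) monoid_scheme" and \<alpha> \<beta> :: "'a \<Rightarrow> rat" and K :: "complex set"
  assumes "group G" and "finite (carrier G)"
    and "class_function G \<alpha>" and "class_function G \<beta>"
    and "\<forall>g\<in>carrier G. \<alpha> g = \<alpha> (inv\<^bsub>G\<^esub> g)"
    and "\<forall>g\<in>carrier G. \<beta> g = \<beta> (inv\<^bsub>G\<^esub> g)"
    and "is_subfield K" and "\<rat> \<subseteq> K" and "K \<subseteq> cyclo_field (order G)"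
    and "H_fun G \<alpha> K = H_fun G \<beta> K"
  shows "(\<forall>\<mu>. cay_eigenvalue G \<alpha> \<mu> \<longrightarrow> \<mu> \<in> K) \<longleftrightarrow>
         (\<forall>\<mu>. cay_eigenvalue G \<beta> \<mu> \<longrightarrow> \<mu> \<in> K)"
proof -
  interpret group G by fact
  interpret A: cayley G \<alpha> by unfold_locales fact+
  interpret B: cayley G \<beta> by unfold_locales fact+
  show ?thesis
    using A.eigenvalues_in_subfield_iff B.eigenvalues_in_subfield_iff assms by simp
qed

end
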